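(* With the notation of the context (level set $\Gamma(t)$ with unit normal $\nu$ and mean curvature $m$; discrete level set $\Gamma^n$ with $\nu^n$ and $m^n$; points $y^\ast=y^\ast(y)\in\Gamma(t_n)$ associated with $y\in\Gamma^n$), there exist constants $M_{14},M_{15}>0$ independent of $(h,\tau)$ such that $$\max_{y\in\Gamma^n,\,0\le n\le T_\tau}|\nu^n(y)-\nu(t_n,y^\ast)|\le M_{14}h^\alpha,$$ $$\max_{y\in\Gamma^n,\,0\le n\le T_\tau}|m^n(y)-m(t_n,y^\ast)|\le M_{15}h^\alpha$$ for all $(h,\tau)\to0$, i.e. for all sufficiently small $(h,\tau)$ under the scale condition and the CFL-condition of the context.
   Context: Setting. $T>0$; $\Omega\subset\mathbb{R}^3$ is a bounded connected open set; $v\in C^4([0,T]\times\bar\Omega;\mathbb{R}^3)$ with $\nabla\cdot v=0$ and $\mathrm{supp}(v)\subset[0,T]\times\Omega$; $f^0\in C^4(\bar\Omega;\mathbb{R})$ with $f^0\equiv0$ in a neighborhood of $\partial\Omega$. The $0$-extensions of $v$ and $f^0$ to $x\in\mathbb{R}^3\setminus\Omega$ are $C^4$-smooth and denoted by the same symbols. Moreover there is a connected open set $\Omega^+$ with $\overline{\Omega^+}\subset\Omega$, $f^0>1$ in $\Omega^+$, $f^0<1$ in $\Omega\setminus\overline{\Omega^+}$, and $\nabla f^0\neq0$ on $\Gamma(0):=\partial\Omega^+$. Let $f$ be the $C^4$-solution of $\partial_tf+v\cdot\nabla f=0$ on $[0,T]\times\mathbb{R}^3$, $f(0,\cdot)=f^0$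 (given by the method of characteristics), $\Omega^+(t)=\{x\in\Omega: f(t,x)>1\}$ and $\Gamma(t)=\{x\in\Omega:f(t,x)=1\}=\partial\Omega^+(t)$, a connected closed $C^4$-surface. Normal and mean curvature. For $\mu_0>0$ let $\Theta_{\mu_0}=\bigcup_{0\le t\le T}\{t\}\times\{y\in\Omega: |y-x|\le\mu_0 \text{ for some } x\in\Gamma(t)\}$. There are $\mu_0>0$ and $0<C_1\le C_2$ with $\Theta_{\mu_0}\subset[0,T]\times\Omega$ and $C_1\le|\nabla f|\le C_2$ on $\Theta_{\mu_0}$; $\mu_0$ is taken small enough that the intersection of $\Gamma(t)$ with the $\mu_0$-ball centered at any $x\in\Gamma(t)$ is almost flat. On $\Theta_{\mu_0}$ set $\nu(t,x)=\frac{\nabla f(t,x)}{|\nabla f(t,x)|}$ and $m(t,x)=-\nabla\cdot\nu(t,x)$; on $\Gamma(t)$, $\nu(t,\cdot)$ is a unit normal and $m(t,x)$ is the mean curvature of $\Gamma(t)$ at $x$ in the direction $\nu(t,x)$. It is supposed that $\nu(t,\cdot)|_{\Gamma(t)}$ is the outer unit normal of $\Gamma(t)$ with respect to $\Omega^+(t)$; otherwise $\nu$ is re-defined as $-\nabla f(t,x)/|\nabla f(t,x)|$. Grid. $h,\tau>0$ are the space and time mesh sizes; $t_n=n\tau$; $T_\tau\in\mathbb{N}$ is such that $T\in[\tau T_\tau,\tau T_\tau+\tau)$. $e^1,e^2,e^3$ is the standard basis of $\mathbb{R}^3$; $B=\{\pm e^1,\pm e^2,\pm e^3,0\}$; $C_h(x)=\prod_{i=1}^3[x_i-\frac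 h2,x_i+\frac h2)$; $\Omega_h=\{x\in\Omega\cap h\mathbb{Z}^3:C_{2h}(x)\subset\Omega\}$; the boundary of $A\subset h\mathbb{Z}^3$ is $\partial A=\{x\in A:\{x\pm he^i:i=1,2,3\}\not\subset A\}$. $D^+_i\phi(x)=\frac{\phi(x+he^i)-\phi(x)}h$, $D^-_i\phi(x)=\frac{\phi(x)-\phi(x-he^i)}h$, $D_i\phi(x)=\frac{\phi(x+he^i)-\phi(x-he^i)}{2h}$, $D^2_i\phi(x)=\frac{\phi(x+he^i)+\phi(x-he^i)-2\phi(x)}{h^2}$, $D^+=(D^+_1,D^+_2,D^+_3)$. Scale condition: $\tau=O(h^{2-\alpha})$ with a fixed $0<\alpha\le1$, understood so that $O(\tau^2)+O(h^2)+O(\tau h)=O(h^\alpha\tau)$. Explicit scheme. $g^0(x)=\frac1{h^3}\int_{C_h(x)}f^0(y)\,dy$, $u^n_i(x)=\frac1{\tau h^3}\int_{\tau n}^{\tau(n+1)}\int_{C_h(x)}v_i(s,y)\,dy\,ds$ for $x\in h\mathbb{Z}^3$, and for $0\le n\le T_\tau-1$, $x\in h\mathbb{Z}^3$, $$\Big(g^{n+1}(x)-\frac17\sum_{\omega\in B}g^n(x+h\omega)\Big)\frac1\tau+\sum_{j=1}^3u^n_j(x)D_jg^n(x)=0 .$$ CFL-condition: $\frac17\pm\frac\tau{2h}u^n_j(x)\ge0$ for all $n,j,x$. Discrete level set. $\Omega^n_+=\{x\in\Omega_h:g^n(x)>1\}$, $\bar\Omega^n_+=\{x+h\omega:x\in\Omega^n_+,\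 \omega\in B\}$, $\Gamma^n=\partial\bar\Omega^n_+$ (discrete boundary). For all sufficiently small $h$ one has $D^+g^n\neq0$ on $\Gamma^n$, and for $y\in\Gamma^n$ $$\nu^n(y)=\frac{D^+g^n(y)}{|D^+g^n(y)|},\qquad m^n(y)=-\frac1{|D^+g^n(y)|}\Big(\sum_{i=1}^3D^2_ig^n(y)-\sum_{i,j=1}^3D^-_iD^+_jg^n(y)\,\nu^n_i(y)\nu^n_j(y)\Big).$$ The points $y^\ast$. There is a constant $M_{13}>0$ independent of $(h,\tau)$, $n$ and $y$ such that, for all sufficiently small $(h,\tau)$ and every $y\in\Gamma^n$, there is a point $y^\ast=y^\ast(y)\in\Gamma(t_n)$ with $y^\ast-y=\mu\,\nu(t_n,y^\ast)$ for some $\mu\in[-\mu_0,\mu_0]$ and $|y^\ast-y|=|\mu|\le M_{13}h^\alpha$; $y^\ast(y)$ denotes this point.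
   Formalization: ν is always ∇f/|∇f| and m = −∇·ν, without the redefinition to the outer normal: since f>1 in Ω⁺(t), the outer normal is −∇f/|∇f|, and then |νⁿ−ν| would tend to 2 because νⁿ = D⁺gⁿ/|D⁺gⁿ| approximates +∇f/|∇f|. *)

theory Defs
  imports "HOL-Analysis.Analysis"
begin

type_synonym R3 = "real^3"

abbreviation e :: "3 \<Rightarrow> R3" where
  "e i \<equiv> axis i 1"

section \<open>Differential calculus\<close>

text \<open>
  \<open>C\<^sup>k\<close> regularity on a set that need not be open, with derivatives taken within the set (one-sided
  at \<open>t = 0\<close> and \<open>t = T\<close> for sets of the form \<open>{0..T} \<times> UNIV\<close>). Recursion is on directional derivatives
  along the standard basis, because the type of the full derivative grows with its order.
\<close>
primrec Ck_on :: "nat \<Rightarrow> ('a::euclidean_space \<Rightarrow> 'b::real_normed_vector) \<Rightarrow> 'a set \<Rightarrow> bool" where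
  "Ck_on 0 \<phi> S \<longleftrightarrow> continuous_on S \<phi>"
| "Ck_on (Suc k) \<phi> S \<longleftrightarrow>
     (\<exists>\<phi>'. (\<forall>x\<in>S. (\<phi> has_derivative \<phi>' x) (at x within S)) \<and>
           (\<forall>b\<in>Basis. Ck_on k (\<lambda>x. \<phi>' x b) S))"

definition grad :: "(R3 \<Rightarrow> real) \<Rightarrow> R3 \<Rightarrow> R3" where
  "grad \<phi> x = (\<chi> i. frechet_derivative \<phi> (at x) (e i))"

definition divergence :: "(R3 \<Rightarrow> R3) \<Rightarrow> R3 \<Rightarrow> real" where
  "divergence F x = (\<Sum>i\<in>UNIV. frechet_derivative F (at x) (e i) $ i)"

section \<open>The level set, its normal and its mean curvature\<close>

definition level_surface :: "R3 set \<Rightarrow> (real \<Rightarrow> R3 \<Rightarrow> real) \<Rightarrow> real \<Rightarrow> R3 set" where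
  "level_surface \<Omega> f t = {x \<in> \<Omega>. f t x = 1}"

definition tube :: "R3 set \<Rightarrow> (real \<Rightarrow> R3 \<Rightarrow> real) \<Rightarrow> real \<Rightarrow> real \<Rightarrow> (real \<times> R3) set" where
  "tube \<Omega> f T \<mu>0 =
     (\<Union>t\<in>{0..T}. {t} \<times> {y \<in> \<Omega>. \<exists>x \<in> level_surface \<Omega> f t. norm (y - x) \<le> \<mu>0})"

text \<open>
  The orientation is that of the gradient of \<open>f\<close>, the same orientation as that of the discrete normal
  built from \<open>D\<^sup>+ g\<close> below. Choosing the opposite sign for both normals (and both curvatures)
  changes none of the errors.
\<close>
definition normal :: "(real \<Rightarrow> R3 \<Rightarrow> real) \<Rightarrow> real \<Rightarrow> R3 \<Rightarrow> R3" where
  "normal f t x = (1 / norm (grad (f t) x)) *\<^sub>R grad (f t) x"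

definition mean_curvature :: "(real \<Rightarrow> R3 \<Rightarrow> real) \<Rightarrow> real \<Rightarrow> R3 \<Rightarrow> real" where
  "mean_curvature f t x = - divergence (normal f t) x"

section \<open>The grid and difference quotients\<close>

definition grid :: "real \<Rightarrow> R3 set" where
  "grid h = {x. \<forall>i. \<exists>k::int. x $ i = h * of_int k}"

definition stencil :: "R3 set" where
  "stencil = {0} \<union> range e \<union> range (\<lambda>i. - e i)"

definition cell :: "real \<Rightarrow> R3 \<Rightarrow> R3 set" where
  "cell h x = {y. \<forall>i. x $ i - h / 2 \<le> y $ i \<and> y $ i < x $ i + h / 2}"

definition grid_domain :: "R3 set \<Rightarrow> real \<Rightarrow> R3 set" where
  "grid_domain \<Omega> h = {x \<in> \<Omega> \<inter> grid h. cell (2 * h) x \<subseteq> \<Omega>}"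

definition discrete_boundary :: "real \<Rightarrow> R3 set \<Rightarrow> R3 set" where
  "discrete_boundary h A = {x \<in> A. \<not> (\<Union>i. {x + h *\<^sub>R e i, x - h *\<^sub>R e i}) \<subseteq> A}"

definition Dplus :: "real \<Rightarrow> 3 \<Rightarrow> (R3 \<Rightarrow> real) \<Rightarrow> R3 \<Rightarrow> real" where
  "Dplus h i \<phi> x = (\<phi> (x + h *\<^sub>R e i) - \<phi> x) / h"

definition Dminus :: "real \<Rightarrow> 3 \<Rightarrow> (R3 \<Rightarrow> real) \<Rightarrow> R3 \<Rightarrow> real" where
  "Dminus h i \<phi> x = (\<phi> x - \<phi> (x - h *\<^sub>R e i)) / h"

definition Dcentral :: "real \<Rightarrow> 3 \<Rightarrow> (R3 \<Rightarrow> real) \<Rightarrow> R3 \<Rightarrow> real" where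
  "Dcentral h i \<phi> x = (\<phi> (x + h *\<^sub>R e i) - \<phi> (x - h *\<^sub>R e i)) / (2 * h)"

definition Dsecond :: "real \<Rightarrow> 3 \<Rightarrow> (R3 \<Rightarrow> real) \<Rightarrow> R3 \<Rightarrow> real" where
  "Dsecond h i \<phi> x = (\<phi> (x + h *\<^sub>R e i) + \<phi> (x - h *\<^sub>R e i) - 2 * \<phi> x) / h\<^sup>2"

definition discrete_grad :: "real \<Rightarrow> (R3 \<Rightarrow> real) \<Rightarrow> R3 \<Rightarrow> R3" where
  "discrete_grad h \<phi> x = (\<chi> i. Dplus h i \<phi> x)"

section \<open>The explicit scheme\<close>

definition velocity_average ::
    "(real \<Rightarrow> R3 \<Rightarrow> R3) \<Rightarrow> real \<Rightarrow> real \<Rightarrow> nat \<Rightarrow> 3 \<Rightarrow> R3 \<Rightarrow> real" where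
  "velocity_average v h \<tau> n i x =
     1 / (\<tau> * h ^ 3) *
       integral {\<tau> * real n..\<tau> * (real n + 1)} (\<lambda>s. integral (cell h x) (\<lambda>y. v s y $ i))"

text \<open>
  Grid functions are total functions on \<open>\<real>\<^sup>3\<close>, of which only the values on \<open>grid h\<close> matter;
  \<open>N\<close> is the number of time steps.
\<close>
definition explicit_scheme ::
    "(real \<Rightarrow> R3 \<Rightarrow> R3) \<Rightarrow> (R3 \<Rightarrow> real) \<Rightarrow> real \<Rightarrow> real \<Rightarrow> nat \<Rightarrow> (nat \<Rightarrow> R3 \<Rightarrow> real) \<Rightarrow> bool" where
  "explicit_scheme v f0 h \<tau> N g \<longleftrightarrow>
     (\<forall>x\<in>grid h. g 0 x = 1 / h ^ 3 * integral (cell h x) f0) \<and>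
     (\<forall>n<N. \<forall>x\<in>grid h.
        (g (Suc n) x - 1 / 7 * (\<Sum>\<omega>\<in>stencil. g n (x + h *\<^sub>R \<omega>))) * (1 / \<tau>)
          + (\<Sum>j\<in>UNIV. velocity_average v h \<tau> n j x * Dcentral h j (g n) x) = 0)"

definition CFL_condition :: "(real \<Rightarrow> R3 \<Rightarrow> R3) \<Rightarrow> real \<Rightarrow> real \<Rightarrow> nat \<Rightarrow> bool" where
  "CFL_condition v h \<tau> N \<longleftrightarrow>
     (\<forall>n<N. \<forall>j. \<forall>x\<in>grid h.
        1 / 7 + \<tau> / (2 * h) * velocity_average v h \<tau> n j x \<ge> 0 \<and>
        1 / 7 - \<tau> / (2 * h) * velocity_average v h \<tau> n j x \<ge> 0)"

text \<open>
  The relation \<open>\<tau> = O(h\<^bsup>2-\<alpha>\<^esup>)\<close>, understood so that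
  \<open>O(\<tau>\<^sup>2) + O(h\<^sup>2) + O(\<tau>h) = O(h\<^bsup>\<alpha>\<^esup>\<tau>)\<close>; the implied constant is \<open>K\<close>. The second conjunct also
  bounds \<open>\<tau>\<close> from below by a multiple of \<open>h\<^bsup>2-\<alpha>\<^esup>\<close>.
\<close>
definition scale_condition :: "real \<Rightarrow> real \<Rightarrow> real \<Rightarrow> real \<Rightarrow> bool" where
  "scale_condition \<alpha> K h \<tau> \<longleftrightarrow>
     \<tau> \<le> K * h powr (2 - \<alpha>) \<and> \<tau>\<^sup>2 + h\<^sup>2 + \<tau> * h \<le> K * (h powr \<alpha> * \<tau>)"

section \<open>The discrete level set, its normal and its mean curvature\<close>

text \<open>In this section \<open>G\<close> is the grid function \<open>g\<^sup>n\<close> at a fixed time step.\<close>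

definition discrete_inside :: "R3 set \<Rightarrow> real \<Rightarrow> (R3 \<Rightarrow> real) \<Rightarrow> R3 set" where
  "discrete_inside \<Omega> h G = {x \<in> grid_domain \<Omega> h. G x > 1}"

definition discrete_surface :: "R3 set \<Rightarrow> real \<Rightarrow> (R3 \<Rightarrow> real) \<Rightarrow> R3 set" where
  "discrete_surface \<Omega> h G =
     discrete_boundary h {x + h *\<^sub>R \<omega> | x \<omega>. x \<in> discrete_inside \<Omega> h G \<and> \<omega> \<in> stencil}"

definition discrete_normal :: "real \<Rightarrow> (R3 \<Rightarrow> real) \<Rightarrow> R3 \<Rightarrow> R3" where
  "discrete_normal h G y = (1 / norm (discrete_grad h G y)) *\<^sub>R discrete_grad h G y"

definition discrete_mean_curvature :: "real \<Rightarrow> (R3 \<Rightarrow> real) \<Rightarrow> R3 \<Rightarrow> real" where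
  "discrete_mean_curvature h G y =
     - (1 / norm (discrete_grad h G y)) *
       ((\<Sum>i\<in>UNIV. Dsecond h i G y)
        - (\<Sum>i\<in>UNIV. \<Sum>j\<in>UNIV. Dminus h i (Dplus h j G) y
             * discrete_normal h G y $ i * discrete_normal h G y $ j))"

text \<open>
  The points \<open>z = y\<^sup>*\<close> on the surface at time \<open>t\<close> associated with \<open>y\<close>, with bound
  \<open>\<bar>z - y\<bar> \<le> M h\<^bsup>\<alpha>\<^esup>\<close>. Uniqueness is not built in.
\<close>
definition associated_point ::
    "R3 set \<Rightarrow> (real \<Rightarrow> R3 \<Rightarrow> real) \<Rightarrow> real \<Rightarrow> real \<Rightarrow> real \<Rightarrow> real \<Rightarrow> real \<Rightarrow> R3 \<Rightarrow> R3 \<Rightarrow> bool" where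
  "associated_point \<Omega> f \<mu>0 M \<alpha> h t y z \<longleftrightarrow>
     z \<in> level_surface \<Omega> f t \<and>
     (\<exists>\<mu>\<in>{-\<mu>0..\<mu>0}. z - y = \<mu> *\<^sub>R normal f t z \<and>
        norm (z - y) = \<bar>\<mu>\<bar> \<and> \<bar>\<mu>\<bar> \<le> M * h powr \<alpha>)"

end

theory Submission
  imports Defs
begin

text \<open>
  The error \<open>g\<^sup>n - f(t\<^sub>n, \<cdot>)\<close> is controlled on the grid together with all its forward differences up to
  second order. Under the CFL condition a step of the scheme is a convex combination of neighbouring
  values, so it contracts the maximum norm; applying a difference operator to the scheme adds only
  terms \<open>\<tau> \<cdot> D u \<cdot> D g\<close> of the same or lower order, and the discrete Gronwall argument goes through.
  The truncation error has differences of order \<open>\<tau>\<^sup>2 + h\<^sup>2 + \<tau> h = O(h\<^bsup>\<alpha>\<^esup> \<tau>)\<close>, which takes four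
  derivatives of \<open>f\<close>; they are bounded because \<open>f\<close> and \<open>v\<close> vanish outside compact sets. Normal and
  mean curvature depend locally Lipschitz continuously on first and second derivatives as long as
  the gradient stays away from zero, and \<open>y\<close> and \<open>y\<^sup>*\<close> are \<open>O(h\<^bsup>\<alpha>\<^esup>)\<close> apart.
\<close>

section \<open>Forward differences up to second order\<close>

text \<open>A bound on the error alone says nothing useful about its differences: dividing an
  O(h^\<alpha>) estimate by \<open>h\<close> or \<open>h^2\<close> destroys it. The error is
  therefore measured throughout in a discrete C^2 norm. The same loss must be avoided for the smooth
  data, and this rests on one fact: difference operators \<open>L\<close> commute with partial
  derivatives, translations and averaging. A Taylor remainder of \<open>L \<phi>\<close> is thus
  governed by a Lipschitz bound on \<open>L\<close> of a partial derivative, uniformly in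
  \<open>h\<close>. Two derivatives pay for \<open>L\<close>, one for the Lipschitz bound and one
  for the Taylor expansion, which makes four for \<open>f\<close>. The \<open>h^2\<close> in the
  truncation error is the numerical diffusion of the 1/7-average. After division by
  \<open>\<tau>\<close> it is still O(h^\<alpha>) only because the scale condition also bounds
  \<open>\<tau>\<close> from below. Only forward differences are tracked, since a
  \<open>Dminus\<close> is a \<open>Dplus\<close> at a shifted grid point, and the estimate lives on
  the whole lattice, where shifts never leave the domain.\<close>

definition difference_ops :: "real \<Rightarrow> ((R3 \<Rightarrow> real) \<Rightarrow> R3 \<Rightarrow> real) set" where
  "difference_ops h =
     {\<lambda>\<phi>. \<phi>} \<union> range (Dplus h) \<union> {\<lambda>\<phi>. Dplus h k (Dplus h l \<phi>) | k l. True}"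

text \<open>A discrete C^2 norm with one constant for all orders, so that the stability estimate
  closes in a single quantity. \<open>X\<close> is \<open>UNIV\<close> for smooth functions and
  \<open>grid h\<close> for the error, since the scheme determines \<open>g\<close> only on the
  grid.\<close>

definition difference_bound :: "R3 set \<Rightarrow> real \<Rightarrow> real \<Rightarrow> (R3 \<Rightarrow> real) \<Rightarrow> bool" where
  "difference_bound X h M \<phi> \<longleftrightarrow> (\<forall>L\<in>difference_ops h. \<forall>x\<in>X. \<bar>L \<phi> x\<bar> \<le> M)"

definition shift_closed :: "real \<Rightarrow> R3 set \<Rightarrow> bool" where
  "shift_closed h X \<longleftrightarrow> (\<forall>x\<in>X. \<forall>i. x + h *\<^sub>R e i \<in> X \<and> x - h *\<^sub>R e i \<in> X)"

lemma shift_closed_UNIV [simp]: "shift_closed h UNIV"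
  by (simp add: shift_closed_def)

lemma shift_closed_grid [simp]: "shift_closed h (grid h)"
proof -
  have "\<exists>k::int. (x + h *\<^sub>R e i) $ j = h * of_int k" "\<exists>k::int. (x - h *\<^sub>R e i) $ j = h * of_int k"
    if "x \<in> grid h" for x i j
  proof -
    from that have "\<exists>k::int. x $ j = h * of_int k" by (simp add: grid_def)
    then obtain k :: int where k: "x $ j = h * of_int k" ..
    show "\<exists>k::int. (x + h *\<^sub>R e i) $ j = h * of_int k"
      by (rule exI[of _ "k + (if i = j then 1 else 0)"]) (simp add: k axis_def algebra_simps)
    show "\<exists>k::int. (x - h *\<^sub>R e i) $ j = h * of_int k"
      by (rule exI[of _ "k - (if i = j then 1 else 0)"]) (simp add: k axis_def algebra_simps)
  qed
  then show ?thesis by (simp add: shift_closed_def grid_def)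
qed

lemma difference_ops_intros [intro, simp]:
  "(\<lambda>\<phi>. \<phi>) \<in> difference_ops h" "Dplus h k \<in> difference_ops h"
  "(\<lambda>\<phi>. Dplus h k (Dplus h l \<phi>)) \<in> difference_ops h"
  by (auto simp: difference_ops_def)

text \<open>The operators are compositions of at most two \<open>Dplus h k\<close>. The step case is
  asked for every \<open>L\<close>, with no count of its order, so a fact checked for one more
  forward difference holds for orders zero, one and two at once.\<close>

lemma difference_ops_induct [consumes 1, case_names id Dplus]:
  assumes "L \<in> difference_ops h" "P (\<lambda>\<phi>. \<phi>)" "\<And>L k. P L \<Longrightarrow> P (\<lambda>\<phi>. Dplus h k (L \<phi>))"
  shows "P L"
proof -
  have "P (Dplus h k)" for k using assms(3)[OF assms(2), of k] by simp
  moreover have "P (\<lambda>\<phi>. Dplus h k (Dplus h l \<phi>))" for k l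
    using assms(3)[OF calculation[of l], of k] by simp
  ultimately show ?thesis using assms(1,2) by (auto simp: difference_ops_def)
qed

lemma difference_ops_linear:
  assumes "L \<in> difference_ops h"
  shows "L (\<lambda>x. a * \<phi> x + b * \<psi> x) = (\<lambda>x. a * L \<phi> x + b * L \<psi> x)"
  using assms
  by (induction arbitrary: \<phi> \<psi> a b rule: difference_ops_induct)
     (auto simp: Dplus_def fun_eq_iff divide_simps algebra_simps)

lemma difference_ops_zero: "L \<in> difference_ops h \<Longrightarrow> L (\<lambda>x. 0) = (\<lambda>x. 0)"
  using difference_ops_linear[of L h 0 _ 0] by simp

lemma difference_ops_add: "L \<in> difference_ops h \<Longrightarrow> L (\<lambda>x. \<phi> x + \<psi> x) = (\<lambda>x. L \<phi> x + L \<psi> x)"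
  using difference_ops_linear[of L h 1 _ 1] by simp

lemma difference_ops_diff: "L \<in> difference_ops h \<Longrightarrow> L (\<lambda>x. \<phi> x - \<psi> x) = (\<lambda>x. L \<phi> x - L \<psi> x)"
  using difference_ops_linear[of L h 1 _ "-1"] by simp

lemma difference_ops_mult: "L \<in> difference_ops h \<Longrightarrow> L (\<lambda>x. c * \<phi> x) = (\<lambda>x. c * L \<phi> x)"
  using difference_ops_linear[of L h c _ 0] by simp

lemma difference_ops_divide: "L \<in> difference_ops h \<Longrightarrow> L (\<lambda>x. \<phi> x / c) = (\<lambda>x. L \<phi> x / c)"
  using difference_ops_mult[of L h "1/c"] by simp

lemma difference_ops_sum:
  assumes "L \<in> difference_ops h"
  shows "L (\<lambda>x. \<Sum>i\<in>I. \<phi> i x) = (\<lambda>x. \<Sum>i\<in>I. L (\<phi> i) x)"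
  by (induction I rule: infinite_finite_induct)
     (simp_all add: difference_ops_zero[OF assms] difference_ops_add[OF assms])

lemma difference_ops_shift:
  assumes "L \<in> difference_ops h"
  shows "L (\<lambda>x. \<phi> (x + a)) = (\<lambda>x. L \<phi> (x + a))"
  using assms
  by (induction arbitrary: \<phi> rule: difference_ops_induct) (auto simp: Dplus_def fun_eq_iff algebra_simps)

lemma difference_ops_shift_minus:
  assumes "L \<in> difference_ops h"
  shows "L (\<lambda>x. \<phi> (x - a)) = (\<lambda>x. L \<phi> (x - a))"
  using difference_ops_shift[OF assms, of \<phi> "-a"] by simp

lemma difference_boundI:
  assumes "\<And>L x. L \<in> difference_ops h \<Longrightarrow> x \<in> X \<Longrightarrow> \<bar>L \<phi> x\<bar> \<le> M"
  shows "difference_bound X h M \<phi>"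
  using assms by (simp add: difference_bound_def)

lemma difference_boundD:
  assumes "difference_bound X h M \<phi>" "x \<in> X"
  shows "\<bar>\<phi> x\<bar> \<le> M" "\<bar>Dplus h k \<phi> x\<bar> \<le> M" "\<bar>Dplus h k (Dplus h l \<phi>) x\<bar> \<le> M"
  using assms(1)[unfolded difference_bound_def, rule_format, OF _ assms(2)]
    difference_ops_intros(1)[of h] difference_ops_intros(2)[of h k] difference_ops_intros(3)[of h k l]
  by blast+

lemma difference_bound_iff:
  "difference_bound X h M \<phi> \<longleftrightarrow> (\<forall>x\<in>X. \<bar>\<phi> x\<bar> \<le> M \<and> (\<forall>k. \<bar>Dplus h k \<phi> x\<bar> \<le> M) \<and>
     (\<forall>k l. \<bar>Dplus h k (Dplus h l \<phi>) x\<bar> \<le> M))"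
proof
  assume "difference_bound X h M \<phi>"
  then show "\<forall>x\<in>X. \<bar>\<phi> x\<bar> \<le> M \<and> (\<forall>k. \<bar>Dplus h k \<phi> x\<bar> \<le> M) \<and>
     (\<forall>k l. \<bar>Dplus h k (Dplus h l \<phi>) x\<bar> \<le> M)"
    using difference_boundD by blast
qed (auto simp: difference_bound_def difference_ops_def)

lemma difference_bound_mono:
  "difference_bound X h M \<phi> \<Longrightarrow> M \<le> M' \<Longrightarrow> X' \<subseteq> X \<Longrightarrow> difference_bound X' h M' \<phi>"
  unfolding difference_bound_def by (meson order_trans subsetD)

lemma difference_bound_add:
  assumes "difference_bound X h M \<phi>" "difference_bound X h N \<psi>"
  shows "difference_bound X h (M + N) (\<lambda>x. \<phi> x + \<psi> x)"
  using assms
  by (auto simp: difference_bound_def difference_ops_add intro!: abs_triangle_ineq[THEN order_trans] add_mono)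

lemma difference_bound_diff:
  assumes "difference_bound X h M \<phi>" "difference_bound X h N \<psi>"
  shows "difference_bound X h (M + N) (\<lambda>x. \<phi> x - \<psi> x)"
  using assms
  by (auto simp: difference_bound_def difference_ops_diff intro!: abs_triangle_ineq4[THEN order_trans] add_mono)

lemma difference_bound_cmult:
  assumes "difference_bound X h M \<phi>"
  shows "difference_bound X h (\<bar>c\<bar> * M) (\<lambda>x. c * \<phi> x)"
  using assms by (auto simp: difference_bound_def difference_ops_mult abs_mult intro: mult_left_mono)

lemma difference_bound_sum:
  assumes "\<And>i. i \<in> I \<Longrightarrow> difference_bound X h (M i) (\<phi> i)"
  shows "difference_bound X h (\<Sum>i\<in>I. M i) (\<lambda>x. \<Sum>i\<in>I. \<phi> i x)"
  using assms
  by (auto simp: difference_bound_def difference_ops_sum intro!: sum_abs[THEN order_trans] sum_mono)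

lemma Dplus_mult:
  "Dplus h k (\<lambda>x. \<phi> x * \<psi> x) = (\<lambda>x. Dplus h k \<phi> x * \<psi> (x + h *\<^sub>R e k) + \<phi> x * Dplus h k \<psi> x)"
  by (cases "h = 0") (auto simp: Dplus_def fun_eq_iff divide_simps algebra_simps)

text \<open>The discrete Leibniz rule, applied twice, leaves four products, each at most
  \<open>M * N\<close>; this is the factor 4. The rule evaluates one factor at shifted points, which
  must stay in \<open>X\<close>.\<close>

lemma difference_bound_mult:
  assumes X: "shift_closed h X"
    and \<phi>: "difference_bound X h M \<phi>" and \<psi>: "difference_bound X h N \<psi>"
  shows "difference_bound X h (4 * (M * N)) (\<lambda>x. \<phi> x * \<psi> x)"
proof (cases "X = {}")
  case True then show ?thesis by (simp add: difference_bound_def)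
next
  case False
  then obtain x0 where "x0 \<in> X" by auto
  then have M0: "0 \<le> M" and N0: "0 \<le> N"
    using difference_boundD(1)[OF \<phi>] difference_boundD(1)[OF \<psi>] abs_ge_zero order_trans by blast+
  have mult: "\<bar>a * b\<bar> \<le> M * N" if "\<bar>a\<bar> \<le> M" "\<bar>b\<bar> \<le> N" for a b :: real
    using that M0 N0 by (simp add: abs_mult mult_mono)
  have sh: "x + h *\<^sub>R e k \<in> X" if "x \<in> X" for x k using X that by (simp add: shift_closed_def)
  have MN: "0 \<le> M * N" using M0 N0 by simp
  show ?thesis unfolding difference_bound_iff
  proof (intro ballI conjI allI)
    fix x k l assume x: "x \<in> X"
    note \<phi>x = difference_boundD[OF \<phi>] and \<psi>x = difference_boundD[OF \<psi>]
    show "\<bar>\<phi> x * \<psi> x\<bar> \<le> 4 * (M * N)"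
      using mult[OF \<phi>x(1)[OF x] \<psi>x(1)[OF x]] MN by linarith
    show "\<bar>Dplus h k (\<lambda>x. \<phi> x * \<psi> x) x\<bar> \<le> 4 * (M * N)"
      unfolding Dplus_mult
      using mult[OF \<phi>x(2)[OF x, of k] \<psi>x(1)[OF sh[OF x, of k]]] mult[OF \<phi>x(1)[OF x] \<psi>x(2)[OF x, of k]] MN
      by linarith
    have shift: "Dplus h k (\<lambda>x. \<psi> (x + h *\<^sub>R e l)) x = Dplus h k \<psi> (x + h *\<^sub>R e l)"
      by (simp add: difference_ops_shift[of "Dplus h k" h])
    show "\<bar>Dplus h k (Dplus h l (\<lambda>x. \<phi> x * \<psi> x)) x\<bar> \<le> 4 * (M * N)"
      unfolding Dplus_mult difference_ops_add[OF difference_ops_intros(2)] shift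
      using mult[OF \<phi>x(3)[OF x, of k l] \<psi>x(1)[OF sh[OF sh[OF x, of k], of l]]]
        mult[OF \<phi>x(2)[OF x, of l] \<psi>x(2)[OF sh[OF x, of l], of k]]
        mult[OF \<phi>x(2)[OF x, of k] \<psi>x(2)[OF sh[OF x, of k], of l]]
        mult[OF \<phi>x(1)[OF x] \<psi>x(3)[OF x, of k l]]
      by linarith
  qed
qed

section \<open>Functions with bounded partial derivatives\<close>

text \<open>Time and space are separated: the time derivative is one-sided at \<open>0\<close> and
  \<open>T\<close>, the space derivative is a full one on R^3. Later estimates vary only one of the
  two at a time.\<close>

definition has_partials ::
    "real \<Rightarrow> (real \<Rightarrow> R3 \<Rightarrow> real) \<Rightarrow> (real \<Rightarrow> R3 \<Rightarrow> real) \<Rightarrow> (3 \<Rightarrow> real \<Rightarrow> R3 \<Rightarrow> real) \<Rightarrow> bool" where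
  "has_partials T \<phi> \<phi>t \<phi>x \<longleftrightarrow> (\<forall>t\<in>{0..T}. \<forall>x.
     ((\<lambda>s. \<phi> s x) has_real_derivative \<phi>t t x) (at t within {0..T}) \<and>
     (\<phi> t has_derivative (\<lambda>u. \<Sum>i\<in>UNIV. u $ i * \<phi>x i t x)) (at x))"

text \<open>Bounds on the whole strip are recorded instead of continuity, because the mean value
  arguments consume sup bounds and R^3 is not compact.\<close>

primrec bounded_Ck :: "real \<Rightarrow> nat \<Rightarrow> (real \<Rightarrow> R3 \<Rightarrow> real) \<Rightarrow> bool" where
  "bounded_Ck T 0 \<phi> \<longleftrightarrow> (\<exists>M. \<forall>t\<in>{0..T}. \<forall>x. \<bar>\<phi> t x\<bar> \<le> M)"
| "bounded_Ck T (Suc k) \<phi> \<longleftrightarrow> (\<exists>M. \<forall>t\<in>{0..T}. \<forall>x. \<bar>\<phi> t x\<bar> \<le> M) \<and>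
     (\<exists>\<phi>t \<phi>x. has_partials T \<phi> \<phi>t \<phi>x \<and> bounded_Ck T k \<phi>t \<and> (\<forall>i. bounded_Ck T k (\<phi>x i)))"

text \<open>The sum of the individual nonnegative constants serves as the common one. It merges
  bounds for several functions or components into a single constant.\<close>

lemma finite_uniform_bound:
  fixes Q :: "'i::finite \<Rightarrow> real \<Rightarrow> bool"
  assumes "\<And>i. \<exists>M\<ge>0. Q i M" "\<And>i M M'. Q i M \<Longrightarrow> M \<le> M' \<Longrightarrow> Q i M'"
  shows "\<exists>M\<ge>0. \<forall>i. Q i M"
proof -
  obtain M where M: "\<And>i. M i \<ge> 0 \<and> Q i (M i)" using assms(1) by metis
  have "M i \<le> (\<Sum>i\<in>UNIV. M i)" for i by (rule member_le_sum) (auto simp: M)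
  moreover have "0 \<le> (\<Sum>i\<in>UNIV. M i)" using M by (simp add: sum_nonneg)
  ultimately show ?thesis using M assms(2) by blast
qed

lemma bounded_Ck_partials:
  assumes "bounded_Ck T (Suc k) \<phi>"
  obtains \<phi>t \<phi>x where "has_partials T \<phi> \<phi>t \<phi>x" "bounded_Ck T k \<phi>t" "\<And>i. bounded_Ck T k (\<phi>x i)"
  using assms by auto

lemma bounded_Ck_Suc: "bounded_Ck T (Suc k) \<phi> \<Longrightarrow> bounded_Ck T k \<phi>"
proof (induction k arbitrary: \<phi>)
  case (Suc k)
  from Suc.prems obtain M \<phi>t \<phi>x where "\<forall>t\<in>{0..T}. \<forall>x. \<bar>\<phi> t x\<bar> \<le> M" "has_partials T \<phi> \<phi>t \<phi>x"
    "bounded_Ck T (Suc k) \<phi>t" "\<And>i. bounded_Ck T (Suc k) (\<phi>x i)"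
    unfolding bounded_Ck.simps(2)[of T "Suc k"] by blast
  with Suc.IH show ?case unfolding bounded_Ck.simps(2)[of T k] by blast
qed auto

lemma bounded_Ck_mono: "bounded_Ck T k \<phi> \<Longrightarrow> j \<le> k \<Longrightarrow> bounded_Ck T j \<phi>"
  by (rule inc_induct[of j k "\<lambda>j. bounded_Ck T j \<phi>"]) (auto intro: bounded_Ck_Suc simp del: bounded_Ck.simps)

lemma has_partials_Dplus:
  assumes "has_partials T \<phi> \<phi>t \<phi>x"
  shows "has_partials T (\<lambda>t. Dplus h k (\<phi> t)) (\<lambda>t. Dplus h k (\<phi>t t)) (\<lambda>i t. Dplus h k (\<phi>x i t))"
  unfolding has_partials_def
proof (intro ballI allI conjI)
  fix t x assume t: "t \<in> {0..T}"
  have dt: "((\<lambda>s. \<phi> s x) has_real_derivative \<phi>t t x) (at t within {0..T})" for x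
    using assms t by (simp add: has_partials_def)
  have dx: "(\<phi> t has_derivative (\<lambda>u. \<Sum>i\<in>UNIV. u $ i * \<phi>x i t x)) (at x)" for x
    using assms t by (simp add: has_partials_def)
  show "((\<lambda>s. Dplus h k (\<phi> s) x) has_real_derivative Dplus h k (\<phi>t t) x) (at t within {0..T})"
    unfolding Dplus_def by (intro DERIV_cdivide DERIV_diff dt)
  have "((\<lambda>x. \<phi> t (x + h *\<^sub>R e k)) has_derivative (\<lambda>u. \<Sum>i\<in>UNIV. u $ i * \<phi>x i t (x + h *\<^sub>R e k))) (at x)"
    by (rule has_derivative_compose[OF _ dx, of "\<lambda>x. x + h *\<^sub>R e k" "\<lambda>u. u"])
       (auto intro!: derivative_eq_intros)
  then have "((\<lambda>x. (1 / h) * (\<phi> t (x + h *\<^sub>R e k) - \<phi> t x)) has_derivative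
      (\<lambda>u. (1 / h) * ((\<Sum>i\<in>UNIV. u $ i * \<phi>x i t (x + h *\<^sub>R e k)) - (\<Sum>i\<in>UNIV. u $ i * \<phi>x i t x)))) (at x)"
    by (intro has_derivative_mult_right has_derivative_diff dx)
  then show "(Dplus h k (\<phi> t) has_derivative (\<lambda>u. \<Sum>i\<in>UNIV. u $ i * Dplus h k (\<phi>x i t) x)) (at x)"
    by (simp add: Dplus_def[abs_def] sum_subtractf[symmetric] sum_divide_distrib right_diff_distrib[symmetric])
qed

text \<open>Difference quotients commute with differentiation. Hence mean value and Taylor arguments
  apply to \<open>L \<phi>\<close> directly, with \<open>L\<close> of the partials as its
  derivatives.\<close>

lemma has_partials_difference_ops:
  assumes "L \<in> difference_ops h" "has_partials T \<phi> \<phi>t \<phi>x"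
  shows "has_partials T (\<lambda>t. L (\<phi> t)) (\<lambda>t. L (\<phi>t t)) (\<lambda>i t. L (\<phi>x i t))"
  using assms
proof (induction arbitrary: \<phi> \<phi>t \<phi>x rule: difference_ops_induct)
  case (Dplus L k)
  show ?case by (rule has_partials_Dplus[OF Dplus.IH[OF Dplus.prems]])
qed

text \<open>The path from \<open>(t, x)\<close> to \<open>(s, y)\<close> is split into a move in
  time at the fixed point \<open>y\<close> and a move in space at the fixed time \<open>t\<close>.
  The 3 comes from bounding a linear form with three coefficients of size \<open>M\<close> term by
  term.\<close>

lemma has_partials_lipschitz:
  assumes p: "has_partials T \<phi> \<phi>t \<phi>x" and M: "0 \<le> M"
    and bt: "\<And>t x. t \<in> {0..T} \<Longrightarrow> \<bar>\<phi>t t x\<bar> \<le> M"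
    and bx: "\<And>i t x. t \<in> {0..T} \<Longrightarrow> \<bar>\<phi>x i t x\<bar> \<le> M"
    and s: "s \<in> {0..T}" and t: "t \<in> {0..T}"
  shows "\<bar>\<phi> s y - \<phi> t x\<bar> \<le> M * \<bar>s - t\<bar> + 3 * M * norm (y - x)"
proof -
  have "norm (\<phi> s y - \<phi> t y) \<le> M * norm (s - t)"
    using p s t bt by (intro field_differentiable_bound[where S="{0..T}" and f'="\<lambda>t. \<phi>t t y"]) (auto simp: has_partials_def)
  moreover have "norm (\<phi> t y - \<phi> t x) \<le> (3 * M) * norm (y - x)"
  proof (rule differentiable_bound[where S=UNIV and f'="\<lambda>x u. \<Sum>i\<in>UNIV. u $ i * \<phi>x i t x"])
    show "(\<phi> t has_derivative (\<lambda>u. \<Sum>i\<in>UNIV. u $ i * \<phi>x i t x)) (at x within UNIV)" for x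
      using p t by (simp add: has_partials_def)
    show "onorm (\<lambda>u. \<Sum>i\<in>UNIV. u $ i * \<phi>x i t x) \<le> 3 * M" for x
    proof (rule onorm_bound)
      fix u :: R3
      have "norm (\<Sum>i\<in>UNIV. u $ i * \<phi>x i t x) \<le> (\<Sum>i\<in>(UNIV::3 set). norm u * M)"
        by (intro sum_norm_le) (auto simp: abs_mult intro!: mult_mono component_le_norm_cart bx t M)
      then show "norm (\<Sum>i\<in>UNIV. u $ i * \<phi>x i t x) \<le> 3 * M * norm u" by (simp add: algebra_simps)
    qed (use M in simp)
  qed auto
  ultimately show ?thesis by simp
qed

lemma bounded_Ck_lipschitz:
  assumes "bounded_Ck T 1 \<phi>"
  shows "\<exists>M\<ge>0. \<forall>t\<in>{0..T}. \<forall>x y. \<bar>\<phi> t x\<bar> \<le> M \<and> \<bar>\<phi> t y - \<phi> t x\<bar> \<le> M * norm (y - x)"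
proof -
  obtain \<phi>t \<phi>x where p: "has_partials T \<phi> \<phi>t \<phi>x" and b: "bounded_Ck T 0 \<phi>t" "\<And>i. bounded_Ck T 0 (\<phi>x i)"
    using bounded_Ck_partials[of T 0 \<phi>] assms by (metis One_nat_def)
  \<comment> \<open>The function and its four partials are indexed by the finite type
    \<open>3 option option\<close>, so that a single \<open>M\<close> bounds all five.\<close>
  define W where "W = (\<lambda>i. case i of None \<Rightarrow> \<phi> | Some None \<Rightarrow> \<phi>t | Some (Some j) \<Rightarrow> \<phi>x j)"
  have "bounded_Ck T 0 \<phi>" using assms by (rule bounded_Ck_mono) simp
  then have W: "bounded_Ck T 0 (W i)" for i
    using b by (auto simp: W_def simp del: bounded_Ck.simps split: option.split)
  have "\<exists>M\<ge>0. \<forall>i. \<forall>t\<in>{0..T}. \<forall>x. \<bar>W i t x\<bar> \<le> M"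
  proof (rule finite_uniform_bound)
    fix i
    obtain M where M: "\<forall>t\<in>{0..T}. \<forall>x. \<bar>W i t x\<bar> \<le> M" using W[of i] by auto
    have "\<bar>W i t x\<bar> \<le> \<bar>M\<bar>" if "t \<in> {0..T}" for t x using M[rule_format, OF that, of x] by linarith
    then show "\<exists>M\<ge>0. \<forall>t\<in>{0..T}. \<forall>x. \<bar>W i t x\<bar> \<le> M" by (intro exI[of _ "\<bar>M\<bar>"]) simp
  qed (meson order_trans)
  then obtain M where M: "M \<ge> 0" and WM: "\<And>i t x. t \<in> {0..T} \<Longrightarrow> \<bar>W i t x\<bar> \<le> M" by blast
  have b0: "\<bar>\<phi> t x\<bar> \<le> M" and bt: "\<bar>\<phi>t t x\<bar> \<le> M" and bx: "\<bar>\<phi>x i t x\<bar> \<le> M" if "t \<in> {0..T}" for i t x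
    using WM[OF that, of None x] WM[OF that, of "Some None" x] WM[OF that, of "Some (Some i)" x]
    by (simp_all add: W_def)
  show ?thesis
  proof (intro exI[of _ "3 * M"] conjI ballI allI)
    fix t x y assume t: "t \<in> {0..T}"
    show "\<bar>\<phi> t x\<bar> \<le> 3 * M" using b0[OF t, of x] M by linarith
    show "\<bar>\<phi> t y - \<phi> t x\<bar> \<le> 3 * M * norm (y - x)"
      using has_partials_lipschitz[OF p M bt bx t t, of y x] by simp
  qed (use M in simp)
qed

lemma has_partials_line:
  assumes p: "has_partials T \<phi> \<phi>t \<phi>x" and t: "t \<in> {0..T}"
  shows "((\<lambda>r. \<phi> t (x + r *\<^sub>R e k)) has_real_derivative \<phi>x k t (x + r *\<^sub>R e k)) (at r within S)"
proof -
  have dx: "(\<phi> t has_derivative (\<lambda>u. \<Sum>i\<in>UNIV. u $ i * \<phi>x i t y)) (at y)" for y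
    using p t by (simp add: has_partials_def)
  have "((\<lambda>r. \<phi> t (x + r *\<^sub>R e k)) has_derivative (\<lambda>u. \<Sum>i\<in>UNIV. (u *\<^sub>R e k) $ i * \<phi>x i t (x + r *\<^sub>R e k))) (at r within S)"
    by (rule has_derivative_compose[OF _ dx]) (auto intro!: derivative_eq_intros)
  moreover have "(\<Sum>i\<in>UNIV. (u *\<^sub>R e k) $ i * \<phi>x i t (x + r *\<^sub>R e k)) = \<phi>x k t (x + r *\<^sub>R e k) * u" for u
    by (simp add: axis_def if_distrib if_distribR sum.delta cong: if_cong)
  ultimately show ?thesis by (simp add: has_field_derivative_def)
qed

text \<open>By the mean value theorem a forward difference is at most the sup of the matching
  partial derivative. Two differences cost two derivatives, and the bound does not depend on
  \<open>h\<close>.\<close>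

lemma bounded_Ck_difference_bound:
  assumes "bounded_Ck T 2 \<phi>"
  shows "\<exists>M\<ge>0. \<forall>h>0. \<forall>t\<in>{0..T}. difference_bound UNIV h M (\<phi> t)"
proof -
  obtain M0 \<phi>t \<phi>x where M0: "\<forall>t\<in>{0..T}. \<forall>x. \<bar>\<phi> t x\<bar> \<le> M0"
    and p: "has_partials T \<phi> \<phi>t \<phi>x" and \<phi>x: "\<And>i. bounded_Ck T 1 (\<phi>x i)"
    using assms unfolding numeral_2_eq_2 bounded_Ck.simps(2)[of T "Suc 0"] One_nat_def by blast
  have "\<forall>i. \<exists>M \<psi>t \<psi>x. (\<forall>t\<in>{0..T}. \<forall>x. \<bar>\<phi>x i t x\<bar> \<le> M) \<and> has_partials T (\<phi>x i) \<psi>t \<psi>x \<and> (\<forall>j. \<exists>M. \<forall>t\<in>{0..T}. \<forall>x. \<bar>\<psi>x j t x\<bar> \<le> M)"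
    using \<phi>x unfolding One_nat_def bounded_Ck.simps by blast
  then obtain M1 \<psi>t \<psi>x where M1: "\<And>i. \<forall>t\<in>{0..T}. \<forall>x. \<bar>\<phi>x i t x\<bar> \<le> M1 i"
    and q: "\<And>i. has_partials T (\<phi>x i) (\<psi>t i) (\<psi>x i)" and "\<forall>i j. \<exists>M. \<forall>t\<in>{0..T}. \<forall>x. \<bar>\<psi>x i j t x\<bar> \<le> M"
    by metis
  then obtain M2 where M2: "\<And>i j. \<forall>t\<in>{0..T}. \<forall>x. \<bar>\<psi>x i j t x\<bar> \<le> M2 i j" by metis
  define M where "M = \<bar>M0\<bar> + (\<Sum>i\<in>UNIV. \<bar>M1 i\<bar>) + (\<Sum>i\<in>UNIV. \<Sum>j\<in>UNIV. \<bar>M2 i j\<bar>)"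
  have s1: "\<bar>M1 i\<bar> \<le> (\<Sum>i\<in>UNIV. \<bar>M1 i\<bar>)" for i
    by (rule member_le_sum) auto
  have s2: "\<bar>M2 i j\<bar> \<le> (\<Sum>i\<in>UNIV. \<Sum>j\<in>UNIV. \<bar>M2 i j\<bar>)" for i j
  proof -
    have "\<bar>M2 i j\<bar> \<le> (\<Sum>j\<in>UNIV. \<bar>M2 i j\<bar>)" by (rule member_le_sum) auto
    also have "\<dots> \<le> (\<Sum>i\<in>UNIV. \<Sum>j\<in>UNIV. \<bar>M2 i j\<bar>)"
      by (rule member_le_sum[where f="\<lambda>i. \<Sum>j\<in>UNIV. \<bar>M2 i j\<bar>"]) (auto intro: sum_nonneg)
    finally show ?thesis .
  qed
  have nn: "0 \<le> (\<Sum>i\<in>UNIV. \<bar>M1 i\<bar>)" "0 \<le> (\<Sum>i\<in>UNIV. \<Sum>j\<in>UNIV. \<bar>M2 i j\<bar>)" by (auto intro!: sum_nonneg)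
  have M: "M \<ge> 0" "\<bar>M0\<bar> \<le> M" "\<bar>M1 i\<bar> \<le> M" "\<bar>M2 i j\<bar> \<le> M" for i j
    using nn s1[of i] s2[of i j] unfolding M_def by linarith+
  have D: "\<bar>Dplus h k (w t) x\<bar> \<le> M" if pp: "has_partials T w wt wx" and b: "\<And>t x. t \<in> {0..T} \<Longrightarrow> \<bar>wx k t x\<bar> \<le> M"
    and h: "h > 0" and t: "t \<in> {0..T}" for w wt wx h k t x
  proof -
    have "norm (w t (x + h *\<^sub>R e k) - w t (x + 0 *\<^sub>R e k)) \<le> M * norm (h - 0)"
      using has_partials_line[OF pp t] b t
      by (intro field_differentiable_bound[where S=UNIV and f="\<lambda>r. w t (x + r *\<^sub>R e k)"]) auto
    then show ?thesis using h by (simp add: Dplus_def field_simps)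
  qed
  have M1': "\<bar>\<phi>x i t x\<bar> \<le> M" and M2': "\<bar>\<psi>x i j t x\<bar> \<le> M" if "t \<in> {0..T}" for i j t x
    using M1[of i, rule_format, OF that, of x] M2[of i j, rule_format, OF that, of x] M(3)[of i] M(4)[of i j]
    by linarith+
  show ?thesis
  proof (intro exI[of _ M] conjI allI impI ballI M)
    fix h t :: real assume h: "h > 0" and t: "t \<in> {0..T}"
    show "difference_bound UNIV h M (\<phi> t)"
      unfolding difference_bound_iff
    proof (intro ballI conjI allI)
      fix x k l
      show "\<bar>\<phi> t x\<bar> \<le> M" using M0[rule_format, OF t, of x] M(2) by linarith
      show "\<bar>Dplus h k (\<phi> t) x\<bar> \<le> M" using D[OF p _ h t, of k x] M1' by blast
      \<comment> \<open>The outer difference is traded for a derivative, which leaves one difference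
        of \<open>\<phi>x k\<close>; this one is in turn traded for
        \<open>\<psi>x k l\<close>.\<close>
      have "\<bar>Dplus h l (\<phi>x k t) x\<bar> \<le> M" if "t \<in> {0..T}" for t x
        using D[OF q[of k] _ h that, of l x] M2' by blast
      then show "\<bar>Dplus h k (Dplus h l (\<phi> t)) x\<bar> \<le> M"
        by (rule D[OF has_partials_Dplus[OF p] _ h t])
    qed
  qed
qed

definition difference_lipschitz :: "real \<Rightarrow> real \<Rightarrow> real \<Rightarrow> (real \<Rightarrow> R3 \<Rightarrow> real) \<Rightarrow> bool" where
  "difference_lipschitz T h M \<phi> \<longleftrightarrow> (\<forall>L\<in>difference_ops h. \<forall>s\<in>{0..T}. \<forall>t\<in>{0..T}. \<forall>x y.
     \<bar>L (\<phi> s) y - L (\<phi> t) x\<bar> \<le> M * (\<bar>s - t\<bar> + norm (y - x)))"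

text \<open>One derivative beyond the two absorbed by \<open>L\<close> yields a Lipschitz constant
  for \<open>L \<phi>\<close> in time and space, the same for all \<open>h > 0\<close>.\<close>

lemma bounded_Ck_difference_lipschitz:
  assumes "bounded_Ck T 3 \<phi>"
  shows "\<exists>M\<ge>0. \<forall>h>0. difference_lipschitz T h M \<phi>"
proof -
  obtain \<phi>t \<phi>x where p: "has_partials T \<phi> \<phi>t \<phi>x" and ct: "bounded_Ck T 2 \<phi>t" and cx: "\<And>i. bounded_Ck T 2 (\<phi>x i)"
    using bounded_Ck_partials[of T 2 \<phi>] assms unfolding numeral_3_eq_3 numeral_2_eq_2 by blast
  obtain Mt where Mt: "Mt \<ge> 0" "\<And>h t. h > 0 \<Longrightarrow> t \<in> {0..T} \<Longrightarrow> difference_bound UNIV h Mt (\<phi>t t)"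
    using bounded_Ck_difference_bound[OF ct] by auto
  obtain Mx where Mx: "\<And>i. Mx i \<ge> 0" "\<And>h t i. h > 0 \<Longrightarrow> t \<in> {0..T} \<Longrightarrow> difference_bound UNIV h (Mx i) (\<phi>x i t)"
    using bounded_Ck_difference_bound[OF cx] by metis
  define M where "M = Mt + (\<Sum>i\<in>UNIV. Mx i)"
  have s1: "Mx i \<le> (\<Sum>i\<in>UNIV. Mx i)" for i by (rule member_le_sum) (auto simp: Mx)
  have M: "Mt \<le> M" "Mx i \<le> M" "0 \<le> M" for i
    using Mt(1) s1[of i] Mx(1)[of i] by (auto simp: M_def)
  show ?thesis
  proof (intro exI[of _ "3 * M"] conjI allI impI)
    fix h :: real assume h: "h > 0"
    show "difference_lipschitz T h (3 * M) \<phi>"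
      unfolding difference_lipschitz_def
    proof (intro ballI allI)
      fix L s t x y assume L: "L \<in> difference_ops h" and st: "s \<in> {0..T}" "t \<in> {0..T}"
      have "\<bar>L (\<phi> s) y - L (\<phi> t) x\<bar> \<le> M * \<bar>s - t\<bar> + 3 * M * norm (y - x)"
      proof (rule has_partials_lipschitz[OF has_partials_difference_ops[OF L p] M(3) _ _ st])
        show "\<bar>L (\<phi>t t) x\<bar> \<le> M" if "t \<in> {0..T}" for t x
          using Mt(2)[OF h that] L M(1) by (auto simp: difference_bound_def intro: order_trans)
        show "\<bar>L (\<phi>x i t) x\<bar> \<le> M" if "t \<in> {0..T}" for i t x
          using Mx(2)[OF h that, of i] L M(2)[of i] by (auto simp: difference_bound_def intro: order_trans)
      qed
      also have "\<dots> \<le> 3 * M * (\<bar>s - t\<bar> + norm (y - x))" using M(3) by (simp add: algebra_simps)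
      finally show "\<bar>L (\<phi> s) y - L (\<phi> t) x\<bar> \<le> 3 * M * (\<bar>s - t\<bar> + norm (y - x))" .
    qed
  qed (use M in simp)
qed

section \<open>Consistency of difference quotients and averages\<close>

lemma difference_lipschitzD:
  assumes "difference_lipschitz T h M \<phi>" "L \<in> difference_ops h" "s \<in> {0..T}" "t \<in> {0..T}"
  shows "\<bar>L (\<phi> s) y - L (\<phi> t) x\<bar> \<le> M * (\<bar>s - t\<bar> + norm (y - x))"
  using assms by (simp add: difference_lipschitz_def)

lemma difference_lipschitz_nonneg:
  assumes "difference_lipschitz T h M \<phi>" "T \<ge> 0"
  shows "M \<ge> 0"
  using difference_lipschitzD[OF assms(1) difference_ops_intros(1), of 0 0 "e 1" 0] assms(2)
  by (simp add: order_trans[OF abs_ge_zero])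

lemma difference_lipschitz_continuous:
  assumes "difference_lipschitz T h M \<phi>" "t \<in> {0..T}"
  shows "continuous_on S (\<phi> t)"
proof -
  have "M \<ge> 0" using difference_lipschitz_nonneg assms by force
  then have "M-lipschitz_on S (\<phi> t)"
    using difference_lipschitzD[OF assms(1) difference_ops_intros(1) assms(2,2)]
    by (intro lipschitz_onI) (auto simp: dist_norm)
  then show ?thesis by (rule lipschitz_on_continuous_on)
qed

text \<open>Mean value theorem for \<open>\<phi>\<close> minus its linear part, whose derivative is
  at most \<open>M * |r|\<close> by the Lipschitz bound. The interval is symmetric about 0 because
  \<open>r\<close> may be negative.\<close>

lemma has_partials_space_taylor:
  assumes p: "has_partials T \<phi> \<phi>t \<phi>x" and t: "t \<in> {0..T}" and M: "M \<ge> 0"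
    and lip: "\<And>y x. \<bar>\<phi>x k t y - \<phi>x k t x\<bar> \<le> M * norm (y - x)"
  shows "\<bar>\<phi> t (x + r *\<^sub>R e k) - \<phi> t x - r * \<phi>x k t x\<bar> \<le> M * r\<^sup>2"
proof -
  let ?w = "\<lambda>\<rho>. \<phi> t (x + \<rho> *\<^sub>R e k) - \<rho> * \<phi>x k t x"
  have "norm (?w r - ?w 0) \<le> (M * \<bar>r\<bar>) * norm (r - 0)"
  proof (rule field_differentiable_bound[where S="{-\<bar>r\<bar>..\<bar>r\<bar>}"])
    fix \<rho> assume \<rho>: "\<rho> \<in> {-\<bar>r\<bar>..\<bar>r\<bar>}"
    show "(?w has_field_derivative (\<phi>x k t (x + \<rho> *\<^sub>R e k) - \<phi>x k t x)) (at \<rho> within {-\<bar>r\<bar>..\<bar>r\<bar>})"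
      by (auto intro!: derivative_eq_intros has_partials_line[OF p t])
    have "\<bar>\<phi>x k t (x + \<rho> *\<^sub>R e k) - \<phi>x k t x\<bar> \<le> M * \<bar>\<rho>\<bar>"
      using lip[of "x + \<rho> *\<^sub>R e k" x] by (simp add: norm_axis_1)
    also have "\<dots> \<le> M * \<bar>r\<bar>" using \<rho> M by (intro mult_left_mono) auto
    finally show "norm (\<phi>x k t (x + \<rho> *\<^sub>R e k) - \<phi>x k t x) \<le> M * \<bar>r\<bar>" by simp
  qed auto
  then show ?thesis by (simp add: power2_eq_square algebra_simps flip: abs_mult)
qed

text \<open>Taylor's formula is used for \<open>L \<phi>\<close> rather than \<open>L\<close> being
  estimated on a remainder, so the full order \<open>r^2\<close> survives even when \<open>L\<close>
  is a second difference quotient of step \<open>h\<close>.\<close>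

lemma difference_bound_space_taylor:
  assumes p: "has_partials T \<phi> \<phi>t \<phi>x" and lip: "difference_lipschitz T h M (\<phi>x k)"
    and t: "t \<in> {0..T}"
  shows "difference_bound UNIV h (M * r\<^sup>2) (\<lambda>x. \<phi> t (x + r *\<^sub>R e k) - \<phi> t x - r * \<phi>x k t x)"
proof (rule difference_boundI)
  fix L x assume L: "L \<in> difference_ops h"
  have M: "M \<ge> 0" using difference_lipschitz_nonneg[OF lip] t by auto
  have "\<bar>L (\<phi> t) (x + r *\<^sub>R e k) - L (\<phi> t) x - r * L (\<phi>x k t) x\<bar> \<le> M * r\<^sup>2"
    using has_partials_space_taylor[OF has_partials_difference_ops[OF L p] t M, of k x r]
      difference_lipschitzD[OF lip L t t] by simp
  then show "\<bar>L (\<lambda>x. \<phi> t (x + r *\<^sub>R e k) - \<phi> t x - r * \<phi>x k t x) x\<bar> \<le> M * r\<^sup>2"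
    by (simp add: difference_ops_diff[OF L] difference_ops_mult[OF L] difference_ops_shift[OF L])
qed

lemma difference_bound_time_taylor:
  assumes p: "has_partials T \<phi> \<phi>t \<phi>x" and lip: "difference_lipschitz T h M \<phi>t"
    and t: "t \<in> {0..T}" "t + \<tau> \<in> {0..T}" and \<tau>: "\<tau> \<ge> 0"
  shows "difference_bound UNIV h (M * \<tau>\<^sup>2) (\<lambda>x. \<phi> (t + \<tau>) x - \<phi> t x - \<tau> * \<phi>t t x)"
proof (rule difference_boundI)
  fix L x assume L: "L \<in> difference_ops h"
  have M: "M \<ge> 0" using difference_lipschitz_nonneg[OF lip] t by auto
  let ?w = "\<lambda>s. L (\<phi> s) x - s * L (\<phi>t t) x"
  have "norm (?w (t + \<tau>) - ?w t) \<le> (M * \<tau>) * norm ((t + \<tau>) - t)"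
  proof (rule field_differentiable_bound[where S="{t..t+\<tau>}"])
    fix s assume s: "s \<in> {t..t+\<tau>}"
    then have sT: "s \<in> {0..T}" using t by auto
    have "((\<lambda>s. L (\<phi> s) x) has_real_derivative L (\<phi>t s) x) (at s within {0..T})"
      using has_partials_difference_ops[OF L p] sT unfolding has_partials_def by blast
    then have "((\<lambda>s. L (\<phi> s) x) has_real_derivative L (\<phi>t s) x) (at s within {t..t+\<tau>})"
      by (rule DERIV_subset) (use t in auto)
    then show "(?w has_field_derivative (L (\<phi>t s) x - L (\<phi>t t) x)) (at s within {t..t+\<tau>})"
      by (auto intro!: derivative_eq_intros)
    have "\<bar>L (\<phi>t s) x - L (\<phi>t t) x\<bar> \<le> M * \<bar>s - t\<bar>"
      using difference_lipschitzD[OF lip L sT t(1), of x x] by simp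
    also have "\<dots> \<le> M * \<tau>" using s M by (intro mult_left_mono) auto
    finally show "norm (L (\<phi>t s) x - L (\<phi>t t) x) \<le> M * \<tau>" by simp
  qed (use \<tau> in auto)
  then have "\<bar>L (\<phi> (t + \<tau>)) x - L (\<phi> t) x - \<tau> * L (\<phi>t t) x\<bar> \<le> M * \<tau>\<^sup>2"
    using \<tau> by (simp add: power2_eq_square algebra_simps)
  then show "\<bar>L (\<lambda>x. \<phi> (t + \<tau>) x - \<phi> t x - \<tau> * \<phi>t t x) x\<bar> \<le> M * \<tau>\<^sup>2"
    by (simp add: difference_ops_diff[OF L] difference_ops_mult[OF L])
qed

text \<open>Expansions with steps \<open>h\<close> and \<open>-h\<close>. Their linear terms cancel
  in the second difference, which gives order \<open>h^2\<close>. First order is enough for the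
  central quotient, since the scheme multiplies it by \<open>\<tau>\<close> and
  \<open>\<tau> * h\<close> is an admissible error.\<close>

lemma
  assumes p: "has_partials T \<phi> \<phi>t \<phi>x" and lip: "difference_lipschitz T h M (\<phi>x k)"
    and t: "t \<in> {0..T}" and h: "h > 0"
  shows difference_bound_Dplus: "difference_bound UNIV h (M * h) (\<lambda>x. Dplus h k (\<phi> t) x - \<phi>x k t x)"
    and difference_bound_Dcentral: "difference_bound UNIV h (M * h) (\<lambda>x. Dcentral h k (\<phi> t) x - \<phi>x k t x)"
    and difference_bound_second_difference:
      "difference_bound UNIV h (2 * M * h\<^sup>2) (\<lambda>x. \<phi> t (x + h *\<^sub>R e k) + \<phi> t (x - h *\<^sub>R e k) - 2 * \<phi> t x)"
proof -
  have f: "difference_bound UNIV h (M * h\<^sup>2) (\<lambda>x. \<phi> t (x + h *\<^sub>R e k) - \<phi> t x - h * \<phi>x k t x)"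
    by (rule difference_bound_space_taylor[OF p lip t])
  have b: "difference_bound UNIV h (M * h\<^sup>2) (\<lambda>x. \<phi> t (x - h *\<^sub>R e k) - \<phi> t x - (- h) * \<phi>x k t x)"
    using difference_bound_space_taylor[OF p lip t, of "-h"] by simp
  have *: "(\<lambda>x. Dplus h k (\<phi> t) x - \<phi>x k t x) = (\<lambda>x. (1 / h) * (\<phi> t (x + h *\<^sub>R e k) - \<phi> t x - h * \<phi>x k t x))"
    using h by (auto simp: Dplus_def fun_eq_iff field_simps)
  show "difference_bound UNIV h (M * h) (\<lambda>x. Dplus h k (\<phi> t) x - \<phi>x k t x)"
    unfolding * using difference_bound_cmult[OF f, of "1/h"] h by (simp add: power2_eq_square)
  have **: "(\<lambda>x. Dcentral h k (\<phi> t) x - \<phi>x k t x) = (\<lambda>x. (1 / (2 * h)) *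
     ((\<phi> t (x + h *\<^sub>R e k) - \<phi> t x - h * \<phi>x k t x) - (\<phi> t (x - h *\<^sub>R e k) - \<phi> t x - (- h) * \<phi>x k t x)))"
    using h by (auto simp: Dcentral_def fun_eq_iff field_simps)
  show "difference_bound UNIV h (M * h) (\<lambda>x. Dcentral h k (\<phi> t) x - \<phi>x k t x)"
    unfolding ** using difference_bound_cmult[OF difference_bound_diff[OF f b], of "1/(2*h)"] h
    by (simp add: power2_eq_square)
  show "difference_bound UNIV h (2 * M * h\<^sup>2) (\<lambda>x. \<phi> t (x + h *\<^sub>R e k) + \<phi> t (x - h *\<^sub>R e k) - 2 * \<phi> t x)"
    using difference_bound_add[OF f b] by (simp add: algebra_simps)
qed

section \<open>Averages over grid cells and time steps\<close>

definition cell_average :: "real \<Rightarrow> (R3 \<Rightarrow> real) \<Rightarrow> R3 \<Rightarrow> real" where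
  "cell_average h \<phi> x = 1 / h ^ 3 * integral (cell h x) \<phi>"

text \<open>The half-open cell lies between the open and the closed cube, which differ by a null
  set.\<close>

lemma cell_integral:
  assumes "h > 0"
  shows "integral (cell h x) \<phi> = integral (cbox (x - (\<chi> i. h / 2)) (x + (\<chi> i. h / 2))) (\<phi> :: R3 \<Rightarrow> real)"
proof (rule integral_spike_set)
  let ?a = "x - (\<chi> i. h / 2)" and ?b = "x + (\<chi> i. h / 2)"
  have neg: "negligible (cbox ?a ?b - box ?a ?b)" by (rule negligible_frontier_interval)
  have sub: "box ?a ?b \<subseteq> cell h x" "cell h x \<subseteq> cbox ?a ?b"
    by (auto simp: cell_def mem_box_cart less_imp_le)
  have "cell h x - cbox ?a ?b = {}" using sub by auto
  then show "negligible {y \<in> cell h x - cbox ?a ?b. \<phi> y \<noteq> 0}" by (metis (no_types, lifting) Collect_empty_eq empty_iff negligible_empty)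
  show "negligible {y \<in> cbox ?a ?b - cell h x. \<phi> y \<noteq> 0}"
    by (rule negligible_subset[OF neg]) (use sub in auto)
qed

lemma cell_integral_shift:
  assumes "h > 0" "continuous_on UNIV (\<phi> :: R3 \<Rightarrow> real)"
  shows "integral (cell h (x + a)) \<phi> = integral (cell h x) (\<lambda>y. \<phi> (y + a))"
proof -
  let ?a = "x - (\<chi> i. h / 2)" and ?b = "x + (\<chi> i. h / 2)"
  have "(\<phi> has_integral integral (cbox (?a + a) (?b + a)) \<phi>) (cbox (?a + a) (?b + a))"
    by (intro integrable_integral integrable_continuous continuous_on_subset[OF assms(2)] subset_UNIV)
  from has_integral_affinity[OF this, of 1 a]
  have "((\<lambda>y. \<phi> (y + a)) has_integral integral (cbox (?a + a) (?b + a)) \<phi>) ((\<lambda>y. y - a) ` cbox (?a + a) (?b + a))"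
    by simp
  moreover have "(\<lambda>y. y - a) ` cbox (?a + a) (?b + a) = cbox ?a ?b"
    using cbox_translation[of "-a" "?a + a" "?b + a"] by (simp add: algebra_simps)
  ultimately have "integral (cbox ?a ?b) (\<lambda>y. \<phi> (y + a)) = integral (cbox (?a + a) (?b + a)) \<phi>"
    by (metis integral_unique)
  then show ?thesis by (simp add: cell_integral[OF assms(1)] algebra_simps)
qed

lemma cell_average_diff:
  assumes "h > 0" "continuous_on UNIV \<phi>" "continuous_on UNIV \<psi>"
  shows "cell_average h (\<lambda>y. \<phi> y - \<psi> y) x = cell_average h \<phi> x - cell_average h \<psi> x"
  using assms unfolding cell_average_def cell_integral[OF assms(1)]
  by (subst integral_diff) (auto intro!: integrable_continuous intro: continuous_on_subset simp: algebra_simps)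

text \<open>Integrating \<open>\<phi> - c\<close> over the cell and dividing by its volume
  \<open>h^3\<close> preserves the bound. The radius \<open>2 * h\<close> generously covers the
  cell, whose points have l1 distance at most 3h/2 from the centre.\<close>

lemma cell_average_bound:
  assumes h: "h > 0" and \<phi>: "continuous_on UNIV \<phi>"
    and B: "\<And>y. norm (y - x) \<le> 2 * h \<Longrightarrow> \<bar>\<phi> y - c\<bar> \<le> B"
  shows "\<bar>cell_average h \<phi> x - c\<bar> \<le> B"
proof -
  let ?a = "x - (\<chi> i. h / 2)" and ?b = "x + (\<chi> i. h / 2)"
  have cont: "measure lborel (cbox ?a ?b) = h ^ 3"
    using content_cbox_cart[of ?a ?b] h by (simp add: interval_eq_empty_cart power3_eq_cube)
  have "\<bar>\<phi> x - c\<bar> \<le> B" using B[of x] h by simp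
  then have B0: "0 \<le> B" by linarith
  have "((\<lambda>y. \<phi> y - c) has_integral integral (cbox ?a ?b) \<phi> - h ^ 3 * c) (cbox ?a ?b)"
    using has_integral_const[of c ?a ?b] cont
    by (intro has_integral_diff integrable_integral integrable_continuous continuous_on_subset[OF \<phi>] subset_UNIV) auto
  moreover have "norm (\<phi> y - c) \<le> B" if "y \<in> cbox ?a ?b" for y
  proof -
    have "norm (y - x) \<le> (\<Sum>i\<in>UNIV. \<bar>(y - x) $ i\<bar>)" by (rule norm_le_l1_cart)
    also have "\<dots> \<le> (\<Sum>i\<in>(UNIV::3 set). h / 2)"
    proof (rule sum_mono)
      fix i
      have "?a $ i \<le> y $ i" "y $ i \<le> ?b $ i" using that by (auto simp: mem_box_cart)
      then show "\<bar>(y - x) $ i\<bar> \<le> h / 2" by (simp only: vector_minus_component vector_add_component vec_lambda_beta)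
    qed
    finally have "norm (y - x) \<le> 2 * h" using h by simp
    then show ?thesis using B by simp
  qed
  ultimately have "norm (integral (cbox ?a ?b) \<phi> - h ^ 3 * c) \<le> B * measure lborel (cbox ?a ?b)"
    by (rule has_integral_bound[OF B0])
  then show ?thesis using h
    by (simp add: cell_average_def cell_integral cont abs_le_iff field_simps)
qed



text \<open>A shifted average is the average of the shifted function, so differences pass under the
  integral. Continuity is carried through the induction because splitting the integral needs
  integrability.\<close>

lemma difference_ops_cell_average:
  assumes "h > 0" "L \<in> difference_ops h" "continuous_on UNIV \<phi>"
  shows "continuous_on UNIV (L \<phi>) \<and> L (cell_average h \<phi>) = cell_average h (L \<phi>)"
  using assms(2,3)
proof (induction rule: difference_ops_induct)
  case (Dplus L k)
  then have c: "continuous_on UNIV (L \<phi>)" by simp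
  have cs: "continuous_on UNIV (\<lambda>x. L \<phi> (x + h *\<^sub>R e k))"
    by (rule continuous_on_compose2[OF c]) (auto intro!: continuous_intros)
  have "Dplus h k (cell_average h (L \<phi>)) = cell_average h (Dplus h k (L \<phi>))"
  proof
    fix x
    show "Dplus h k (cell_average h (L \<phi>)) x = cell_average h (Dplus h k (L \<phi>)) x"
    using cell_average_diff[OF assms(1) cs c, of x]
    by (auto simp: Dplus_def[abs_def] cell_average_def cell_integral_shift[OF assms(1) c] divide_inverse
        integral_mult_left simp flip: right_diff_distrib)
  qed
  moreover have "continuous_on UNIV (Dplus h k (L \<phi>))"
    unfolding Dplus_def[abs_def] divide_inverse by (intro continuous_intros c cs)
  moreover have "L (cell_average h \<phi>) = cell_average h (L \<phi>)" using Dplus by simp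
  ultimately show ?case by simp
qed simp

lemma difference_ops_integral:
  assumes "L \<in> difference_ops h" "\<And>x. (\<lambda>s. w s x) integrable_on I"
  shows "(\<lambda>s. L (w s) x) integrable_on I \<and> L (\<lambda>x. integral I (\<lambda>s. w s x)) x = integral I (\<lambda>s. L (w s) x)"
  using assms
proof (induction arbitrary: x rule: difference_ops_induct)
  case (Dplus L k)
  then show ?case
    by (auto simp: Dplus_def divide_inverse integral_diff intro!: integrable_on_mult_left integrable_diff)
qed auto

text \<open>The times \<open>s\<close> and \<open>t\<close> are kept apart so that the estimate
  serves both the initial data (\<open>s = t\<close>) and the velocity, which is averaged over a
  time step.\<close>

lemma cell_average_error:
  assumes h: "h > 0" and lip: "difference_lipschitz T h M \<phi>" and L: "L \<in> difference_ops h"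
    and s: "s \<in> {0..T}" and t: "t \<in> {0..T}"
  shows "\<bar>L (cell_average h (\<phi> s)) x - L (\<phi> t) x\<bar> \<le> M * (\<bar>s - t\<bar> + 2 * h)"
proof -
  have M: "M \<ge> 0" using difference_lipschitz_nonneg[OF lip] t by auto
  have c: "continuous_on UNIV (\<phi> s)" by (rule difference_lipschitz_continuous[OF lip s])
  show ?thesis
    unfolding difference_ops_cell_average[OF h L c, THEN conjunct2]
  proof (rule cell_average_bound[OF h difference_ops_cell_average[OF h L c, THEN conjunct1]])
    fix y assume y: "norm (y - x) \<le> 2 * h"
    show "\<bar>L (\<phi> s) y - L (\<phi> t) x\<bar> \<le> M * (\<bar>s - t\<bar> + 2 * h)"
      by (rule order_trans[OF difference_lipschitzD[OF lip L s t]]) (use y M in \<open>auto intro!: mult_left_mono\<close>)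
  qed
qed

lemma difference_bound_cell_average:
  assumes "h > 0" "difference_lipschitz T h M \<phi>" "t \<in> {0..T}"
  shows "difference_bound UNIV h (2 * M * h) (\<lambda>x. cell_average h (\<phi> t) x - \<phi> t x)"
  using cell_average_error[OF assms(1,2) _ assms(3,3)]
  by (auto intro!: difference_boundI simp: difference_ops_diff algebra_simps)

lemma difference_bound_velocity_average:
  assumes h: "h > 0" and \<tau>: "\<tau> > 0" and T: "\<tau> * (real n + 1) \<le> T"
    and lip: "difference_lipschitz T h M (\<lambda>t x. v t x $ i)"
  shows "difference_bound UNIV h (2 * M * (\<tau> + h)) (\<lambda>x. velocity_average v h \<tau> n i x - v (\<tau> * real n) x $ i)"
proof (rule difference_boundI)
  fix L x assume L: "L \<in> difference_ops h"
  let ?I = "{\<tau> * real n..\<tau> * (real n + 1)}" and ?t = "\<tau> * real n"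
  have I: "?I \<subseteq> {0..T}" using T \<tau> by auto
  have t: "?t \<in> {0..T}" "?t \<le> \<tau> * (real n + 1)" using T \<tau> by (auto simp: algebra_simps)
  have M: "M \<ge> 0" using difference_lipschitz_nonneg[OF lip] t by auto
  let ?w = "\<lambda>s. cell_average h (\<lambda>y. v s y $ i)"
  have cont: "continuous_on UNIV (\<lambda>y. v s y $ i)" if "s \<in> {0..T}" for s
    by (rule difference_lipschitz_continuous[OF lip that])
  \<comment> \<open>Lipschitz continuity in time makes the cell averages integrable over the step,
    which permits pulling \<open>L\<close> under the time integral.\<close>
  have "M-lipschitz_on ?I (\<lambda>s. ?w s x)" for x
  proof (rule lipschitz_onI)
    fix s s' assume "s \<in> ?I" "s' \<in> ?I"
    then have s: "s \<in> {0..T}" "s' \<in> {0..T}" using I by auto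
    have "\<bar>cell_average h (\<lambda>y. v s y $ i - v s' y $ i) x - 0\<bar> \<le> M * \<bar>s - s'\<bar>"
      using difference_lipschitzD[OF lip difference_ops_intros(1) s, of x x for x]
      by (intro cell_average_bound[OF h] continuous_on_diff cont s) auto
    then show "dist (?w s x) (?w s' x) \<le> M * dist s s'"
      using cell_average_diff[OF h cont[OF s(1)] cont[OF s(2)], of x] by (simp add: dist_real_def)
  qed (rule M)
  then have int: "(\<lambda>s. ?w s x) integrable_on ?I" for x
    by (intro integrable_continuous_interval lipschitz_on_continuous_on)
  have avg: "velocity_average v h \<tau> n i = (\<lambda>x. (1 / \<tau>) * integral ?I (\<lambda>s. ?w s x))"
    by (simp add: velocity_average_def cell_average_def fun_eq_iff)
  have Lint: "(\<lambda>s. L (?w s) x) integrable_on ?I \<and> L (\<lambda>x. integral ?I (\<lambda>s. ?w s x)) x = integral ?I (\<lambda>s. L (?w s) x)"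
    by (rule difference_ops_integral[OF L int])
  \<comment> \<open>The point value is subtracted as a constant, whose integral over the step is
    \<open>\<tau>\<close> times itself; dividing the resulting bound by \<open>\<tau>\<close> gives
    the claim.\<close>
  have "((\<lambda>s. L (?w s) x - L (\<lambda>y. v ?t y $ i) x) has_integral
      integral ?I (\<lambda>s. L (?w s) x) - \<tau> * L (\<lambda>y. v ?t y $ i) x) ?I"
    using Lint has_integral_const_real[of "L (\<lambda>y. v ?t y $ i) x" ?t "\<tau> * (real n + 1)"] t(2)
    by (intro has_integral_diff integrable_integral) (auto simp: algebra_simps)
  then have "norm (integral ?I (\<lambda>s. L (?w s) x) - \<tau> * L (\<lambda>y. v ?t y $ i) x) \<le> (2 * M * (\<tau> + h)) * measure lborel ?I"
  proof (rule has_integral_bound_real[OF _ finite.emptyI, rotated])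
    fix s assume "s \<in> ?I - {}"
    then have s: "s \<in> ?I" by simp
    have "\<bar>L (?w s) x - L (\<lambda>y. v ?t y $ i) x\<bar> \<le> M * (\<bar>s - ?t\<bar> + 2 * h)"
      using cell_average_error[OF h lip L _ t(1), of s x] s I by auto
    also have "\<dots> \<le> M * (2 * (\<tau> + h))"
      using s h \<tau> M by (intro mult_left_mono) (auto simp: algebra_simps)
    finally show "norm (L (?w s) x - L (\<lambda>y. v ?t y $ i) x) \<le> 2 * M * (\<tau> + h)" by (simp add: algebra_simps)
  qed (use M h \<tau> in auto)
  then have "\<bar>integral ?I (\<lambda>s. L (?w s) x) - \<tau> * L (\<lambda>y. v ?t y $ i) x\<bar> \<le> (2 * M * (\<tau> + h)) * \<tau>"
    using t(2) by (simp add: algebra_simps)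
  then have "\<bar>(1 / \<tau>) * integral ?I (\<lambda>s. L (?w s) x) - L (\<lambda>y. v ?t y $ i) x\<bar> \<le> 2 * M * (\<tau> + h)"
    using \<tau> by (simp add: abs_le_iff field_simps)
  then show "\<bar>L (\<lambda>x. velocity_average v h \<tau> n i x - v (\<tau> * real n) x $ i) x\<bar> \<le> 2 * M * (\<tau> + h)"
    unfolding difference_ops_diff[OF L] avg difference_ops_mult[OF L] using Lint by simp
qed

section \<open>Stability of the scheme\<close>

lemma sum_stencil: "(\<Sum>\<omega>\<in>stencil. F \<omega>) = F 0 + (\<Sum>i\<in>UNIV. F (e i) + F (- e i))" for F :: "R3 \<Rightarrow> real"
proof -
  have ne: "e i \<noteq> 0" "- e i \<noteq> 0" "e i \<noteq> - e j" for i j :: 3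
    by (auto simp: axis_eq_axis vec_eq_iff axis_def)
  have inj: "inj e" "inj (\<lambda>i. - e i)" by (auto simp: inj_def axis_eq_axis)
  have "stencil = insert 0 (range e \<union> range (\<lambda>i. - e i))" by (auto simp: stencil_def)
  also have "sum F \<dots> = F 0 + (sum F (range e) + sum F (range (\<lambda>i. - e i)))"
  proof -
    have "range e \<inter> range (\<lambda>i. - e i) = {}" using ne(3) by blast
    moreover have "0 \<notin> range e \<union> range (\<lambda>i. - e i)" using ne(1,2) by fastforce
    ultimately show ?thesis by (simp add: sum.union_disjoint)
  qed
  also have "\<dots> = F 0 + (\<Sum>i\<in>UNIV. F (e i) + F (- e i))"
    by (simp add: sum.reindex[OF inj(1)] sum.reindex[OF inj(2)] sum.distrib o_def)
  finally show ?thesis .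
qed

text \<open>The scheme solved for \<open>g (Suc n)\<close>. As a map of its own it can also be
  applied to \<open>f\<close>, for the truncation error, and to \<open>g - f\<close>, for the
  propagation of the error.\<close>

definition scheme_step :: "real \<Rightarrow> real \<Rightarrow> (3 \<Rightarrow> R3 \<Rightarrow> real) \<Rightarrow> (R3 \<Rightarrow> real) \<Rightarrow> R3 \<Rightarrow> real" where
  "scheme_step h \<tau> u \<psi> x =
     1 / 7 * (\<Sum>\<omega>\<in>stencil. \<psi> (x + h *\<^sub>R \<omega>)) - \<tau> * (\<Sum>j\<in>UNIV. u j x * Dcentral h j \<psi> x)"

text \<open>The weights add up to 1/7 + 3 * 2/7 = 1, whatever \<open>u\<close> is, and the CFL
  condition says that they are nonnegative.\<close>

lemma scheme_step_convex:
  "scheme_step h \<tau> u \<psi> x = 1 / 7 * \<psi> x + (\<Sum>j\<in>UNIV.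
     (1 / 7 - \<tau> / (2 * h) * u j x) * \<psi> (x + h *\<^sub>R e j) + (1 / 7 + \<tau> / (2 * h) * u j x) * \<psi> (x - h *\<^sub>R e j))"
  unfolding scheme_step_def sum_stencil
  by (simp add: Dcentral_def sum.distrib sum_subtractf sum_distrib_left algebra_simps diff_divide_distrib)

lemma scheme_step_bound:
  assumes cfl: "\<And>j. 1 / 7 + \<tau> / (2 * h) * u j x \<ge> 0" "\<And>j. 1 / 7 - \<tau> / (2 * h) * u j x \<ge> 0"
    and X: "shift_closed h X" "x \<in> X" and B: "\<And>x. x \<in> X \<Longrightarrow> \<bar>\<psi> x\<bar> \<le> B"
  shows "\<bar>scheme_step h \<tau> u \<psi> x\<bar> \<le> B"
proof -
  have "\<bar>(1 / 7 - \<tau> / (2 * h) * u j x) * \<psi> (x + h *\<^sub>R e j) + (1 / 7 + \<tau> / (2 * h) * u j x) * \<psi> (x - h *\<^sub>R e j)\<bar> \<le> 2 / 7 * B" for j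
  proof -
    have "x + h *\<^sub>R e j \<in> X" "x - h *\<^sub>R e j \<in> X" using X by (auto simp: shift_closed_def)
    then have "\<bar>(1 / 7 - \<tau> / (2 * h) * u j x) * \<psi> (x + h *\<^sub>R e j)\<bar> \<le> (1 / 7 - \<tau> / (2 * h) * u j x) * B"
      "\<bar>(1 / 7 + \<tau> / (2 * h) * u j x) * \<psi> (x - h *\<^sub>R e j)\<bar> \<le> (1 / 7 + \<tau> / (2 * h) * u j x) * B"
      using cfl[of j] B by (simp_all only: abs_mult abs_of_nonneg mult_left_mono)
    moreover have "(1 / 7 - \<tau> / (2 * h) * u j x) * B + (1 / 7 + \<tau> / (2 * h) * u j x) * B = 2 / 7 * B"
      by (simp add: algebra_simps)
    ultimately show ?thesis by linarith
  qed
  then have "\<bar>\<Sum>j\<in>UNIV. (1 / 7 - \<tau> / (2 * h) * u j x) * \<psi> (x + h *\<^sub>R e j) + (1 / 7 + \<tau> / (2 * h) * u j x) * \<psi> (x - h *\<^sub>R e j)\<bar>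
      \<le> (\<Sum>j\<in>(UNIV :: 3 set). 2 / 7 * B)"
    by (intro sum_abs[THEN order_trans] sum_mono) auto
  moreover have "\<bar>1 / 7 * \<psi> x\<bar> \<le> 1 / 7 * B" using B[OF X(2)] by simp
  ultimately show ?thesis unfolding scheme_step_convex by simp
qed

text \<open>Reduces the central quotient to the tracked forward differences at the price of one
  backward shift, one reason why \<open>shift_closed\<close> asks for both shifts.\<close>

lemma Dcentral_eq_Dplus: "Dcentral h j \<psi> x = (Dplus h j \<psi> x + Dplus h j \<psi> (x - h *\<^sub>R e j)) / 2"
  by (simp add: Dcentral_def Dplus_def divide_simps)

lemma Dcentral_bound:
  assumes "shift_closed h X" "x \<in> X" "\<And>x. x \<in> X \<Longrightarrow> \<bar>Dplus h j \<psi> x\<bar> \<le> B"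
  shows "\<bar>Dcentral h j \<psi> x\<bar> \<le> B"
proof -
  have "x - h *\<^sub>R e j \<in> X" using assms by (auto simp: shift_closed_def)
  with assms(2,3) have "\<bar>Dplus h j \<psi> x\<bar> \<le> B" "\<bar>Dplus h j \<psi> (x - h *\<^sub>R e j)\<bar> \<le> B" by auto
  then show ?thesis unfolding Dcentral_eq_Dplus abs_le_iff by (simp add: field_simps)
qed

lemma difference_ops_Dcentral:
  assumes "L \<in> difference_ops h"
  shows "L (Dcentral h j \<psi>) = Dcentral h j (L \<psi>)"
  unfolding Dcentral_def[abs_def] divide_inverse difference_ops_mult[OF assms]
    difference_ops_divide[OF assms, unfolded divide_inverse] difference_ops_diff[OF assms] difference_ops_shift[OF assms]
    difference_ops_shift_minus[OF assms] ..

text \<open>The 1/7-average commutes with differences; the variable coefficients \<open>u j\<close>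
  do not, and the Leibniz rule leaves a commutator. In it \<open>\<psi>\<close> carries one
  difference only, no more than on the left-hand side.\<close>

lemma Dplus_scheme_step:
  "Dplus h k (scheme_step h \<tau> u \<psi>) = (\<lambda>x. scheme_step h \<tau> u (Dplus h k \<psi>) x
     - \<tau> * (\<Sum>j\<in>UNIV. Dplus h k (u j) x * Dcentral h j \<psi> (x + h *\<^sub>R e k)))"
proof -
  note D = difference_ops_intros(2)[of h k]
  have "Dplus h k (\<lambda>x. u j x * Dcentral h j \<psi> x) =
      (\<lambda>x. Dplus h k (u j) x * Dcentral h j \<psi> (x + h *\<^sub>R e k) + u j x * Dcentral h j (Dplus h k \<psi>) x)" for j
    by (simp add: Dplus_mult difference_ops_Dcentral[OF D])
  then show ?thesis
    unfolding scheme_step_def[abs_def] difference_ops_diff[OF D] difference_ops_mult[OF D] difference_ops_sum[OF D]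
      difference_ops_shift[OF D]
    by (simp add: fun_eq_iff sum.distrib algebra_simps)
qed

text \<open>Differencing the step twice produces three commutators, each a sum over three directions
  of terms at most \<open>\<tau> * U * E\<close>; this is \<open>9 * U * \<tau>\<close>. Counting
  \<open>Dcentral\<close> as one difference, \<open>\<psi>\<close> never carries more than two, so
  \<open>E\<close> controls every term.\<close>

lemma difference_bound_scheme_step:
  assumes cfl: "\<And>j x. x \<in> X \<Longrightarrow> 1 / 7 + \<tau> / (2 * h) * u j x \<ge> 0" "\<And>j x. x \<in> X \<Longrightarrow> 1 / 7 - \<tau> / (2 * h) * u j x \<ge> 0"
    and X: "shift_closed h X" and \<tau>: "\<tau> \<ge> 0" and U: "U \<ge> 0" and E: "E \<ge> 0"
    and u: "\<And>j. difference_bound X h U (u j)" and \<psi>: "difference_bound X h E \<psi>"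
  shows "difference_bound X h ((1 + 9 * U * \<tau>) * E) (scheme_step h \<tau> u \<psi>)"
proof -
  note \<psi>D = difference_boundD[OF \<psi>] and uD = difference_boundD[OF u]
  have sh: "x + h *\<^sub>R e k \<in> X" if "x \<in> X" for x k using X that by (simp add: shift_closed_def)
  have step: "\<bar>scheme_step h \<tau> u \<psi> x\<bar> \<le> B" if "x \<in> X" "\<And>x. x \<in> X \<Longrightarrow> \<bar>\<psi> x\<bar> \<le> B" for \<psi> x B
    using scheme_step_bound[of \<tau> h u x X \<psi> B] cfl X that by blast
  have prod: "\<bar>\<tau> * (\<Sum>j\<in>UNIV. a j * b j)\<bar> \<le> 3 * U * \<tau> * E"
    if "\<And>j. \<bar>a j\<bar> \<le> U" "\<And>j. \<bar>b j\<bar> \<le> E" for a b :: "3 \<Rightarrow> real"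
  proof -
    have "\<bar>\<Sum>j\<in>UNIV. a j * b j\<bar> \<le> (\<Sum>j\<in>(UNIV::3 set). U * E)"
      using that U E by (intro sum_abs[THEN order_trans] sum_mono) (simp add: abs_mult mult_mono)
    then have "\<tau> * \<bar>\<Sum>j\<in>UNIV. a j * b j\<bar> \<le> \<tau> * (3 * (U * E))" using \<tau> by (intro mult_left_mono) auto
    then show ?thesis using \<tau> by (simp add: abs_mult algebra_simps)
  qed
  have nn: "0 \<le> U * \<tau> * E" using U E \<tau> by simp
  show ?thesis
    unfolding difference_bound_iff
  proof (intro ballI conjI allI)
    fix x k l assume x: "x \<in> X"
    have "\<bar>scheme_step h \<tau> u \<psi> x\<bar> \<le> E" using step[OF x] \<psi>D(1) by blast
    then show "\<bar>scheme_step h \<tau> u \<psi> x\<bar> \<le> (1 + 9 * U * \<tau>) * E" using nn by (simp add: algebra_simps)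
    have S1: "\<bar>scheme_step h \<tau> u (Dplus h k \<psi>) x\<bar> \<le> E" for k using step[OF x] \<psi>D(2) by blast
    have S2: "\<bar>scheme_step h \<tau> u (Dplus h k (Dplus h l \<psi>)) x\<bar> \<le> E" using step[OF x] \<psi>D(3) by blast
    have C1: "\<bar>Dcentral h j \<psi> y\<bar> \<le> E" if "y \<in> X" for j y
      using Dcentral_bound[OF X that] \<psi>D(2) by blast
    have C2: "\<bar>Dcentral h j (Dplus h i \<psi>) y\<bar> \<le> E" if "y \<in> X" for i j y
      using Dcentral_bound[OF X that] \<psi>D(3) by blast
    have P1: "\<bar>\<tau> * (\<Sum>j\<in>UNIV. Dplus h k (u j) x * Dcentral h j \<psi> (x + h *\<^sub>R e k))\<bar> \<le> 3 * U * \<tau> * E" for k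
      by (intro prod uD(2) C1 sh x)
    then show "\<bar>Dplus h k (scheme_step h \<tau> u \<psi>) x\<bar> \<le> (1 + 9 * U * \<tau>) * E"
    proof -
      have "(1 + 9 * U * \<tau>) * E = E + 9 * (U * \<tau> * E)" "3 * U * \<tau> * E = 3 * (U * \<tau> * E)"
        by (simp_all add: algebra_simps)
      then show ?thesis unfolding Dplus_scheme_step using S1[of k] P1[of k] nn by linarith
    qed
    have P2: "\<bar>\<tau> * (\<Sum>j\<in>UNIV. Dplus h k (u j) x * Dcentral h j (Dplus h l \<psi>) (x + h *\<^sub>R e k))\<bar> \<le> 3 * U * \<tau> * E"
      by (intro prod uD(2) C2 sh x)
    have P3: "\<bar>\<tau> * (\<Sum>j\<in>UNIV. Dplus h k (Dplus h l (u j)) x * Dcentral h j \<psi> (x + h *\<^sub>R e k + h *\<^sub>R e l))\<bar> \<le> 3 * U * \<tau> * E"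
      by (intro prod uD(3) C1 sh x)
    have P4: "\<bar>\<tau> * (\<Sum>j\<in>UNIV. Dplus h l (u j) x * Dcentral h j (Dplus h k \<psi>) (x + h *\<^sub>R e l))\<bar> \<le> 3 * U * \<tau> * E"
      by (intro prod uD(2) C2 sh x)
    note D = difference_ops_intros(2)[of h k]
    \<comment> \<open>The first-order formula is differenced again: its main term yields the first
      commutator, and the Leibniz rule splits its own commutator into the other two.\<close>
    have "Dplus h k (Dplus h l (scheme_step h \<tau> u \<psi>)) x =
        scheme_step h \<tau> u (Dplus h k (Dplus h l \<psi>)) x
        - \<tau> * (\<Sum>j\<in>UNIV. Dplus h k (u j) x * Dcentral h j (Dplus h l \<psi>) (x + h *\<^sub>R e k))
        - \<tau> * (\<Sum>j\<in>UNIV. Dplus h k (Dplus h l (u j)) x * Dcentral h j \<psi> (x + h *\<^sub>R e k + h *\<^sub>R e l))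
        - \<tau> * (\<Sum>j\<in>UNIV. Dplus h l (u j) x * Dcentral h j (Dplus h k \<psi>) (x + h *\<^sub>R e l))"
      unfolding Dplus_scheme_step[of h l] difference_ops_diff[OF D] difference_ops_mult[OF D] difference_ops_sum[OF D]
        Dplus_scheme_step[of h k] Dplus_mult difference_ops_shift[OF D] difference_ops_Dcentral[OF D]
      by (simp add: Dplus_def[of h k "\<lambda>x. \<tau>"] sum.distrib algebra_simps)
    then show "\<bar>Dplus h k (Dplus h l (scheme_step h \<tau> u \<psi>)) x\<bar> \<le> (1 + 9 * U * \<tau>) * E"
      using S2 P2 P3 P4 by (simp add: algebra_simps abs_le_iff)
  qed
qed

text \<open>Discrete Gronwall inequality. \<open>R\<close> is the local error per unit time, so
  \<open>n\<close> steps contribute \<open>n * \<tau> * R\<close>, and the growth factor stays below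
  an exponential of the elapsed time.\<close>

lemma difference_bound_iterate:
  assumes cfl: "\<And>n j x. n < N \<Longrightarrow> x \<in> X \<Longrightarrow> 1 / 7 + \<tau> / (2 * h) * u n j x \<ge> 0"
      "\<And>n j x. n < N \<Longrightarrow> x \<in> X \<Longrightarrow> 1 / 7 - \<tau> / (2 * h) * u n j x \<ge> 0"
    and X: "shift_closed h X" and \<tau>: "\<tau> \<ge> 0" and U: "U \<ge> 0" and E0: "E0 \<ge> 0" and R: "R \<ge> 0"
    and u: "\<And>n j. n < N \<Longrightarrow> difference_bound X h U (u n j)"
    and \<psi>0: "difference_bound X h E0 (\<psi> 0)"
    and step: "\<And>n. n < N \<Longrightarrow> difference_bound X h (\<tau> * R) (\<lambda>x. \<psi> (Suc n) x - scheme_step h \<tau> (u n) (\<psi> n) x)"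
    and n: "n \<le> N"
  shows "difference_bound X h (exp (9 * U * (real n * \<tau>)) * (E0 + real n * \<tau> * R)) (\<psi> n)"
proof -
  let ?c = "1 + 9 * U * \<tau>"
  have c: "?c \<ge> 1" using U \<tau> by simp
  have "difference_bound X h (?c ^ n * (E0 + real n * \<tau> * R)) (\<psi> n)"
    using n
  proof (induction n)
    case 0 then show ?case using \<psi>0 by simp
  next
    case (Suc n)
    then have n: "n < N" by simp
    have E: "0 \<le> ?c ^ n * (E0 + real n * \<tau> * R)" using c E0 R \<tau> by simp
    have "difference_bound X h (?c * (?c ^ n * (E0 + real n * \<tau> * R))) (scheme_step h \<tau> (u n) (\<psi> n))"
      using Suc.IH n by (intro difference_bound_scheme_step cfl u X \<tau> U E) auto
    from difference_bound_add[OF this step[OF n]]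
    have "difference_bound X h (?c * (?c ^ n * (E0 + real n * \<tau> * R)) + \<tau> * R) (\<psi> (Suc n))" by simp
    moreover have "?c * (?c ^ n * (E0 + real n * \<tau> * R)) + \<tau> * R \<le> ?c ^ Suc n * (E0 + real (Suc n) * \<tau> * R)"
    proof -
      \<comment> \<open>The new local error is absorbed under the growth factor, which is at least
        1; this keeps the induction bound in product form.\<close>
      have "1 * (\<tau> * R) \<le> ?c ^ Suc n * (\<tau> * R)" using c \<tau> R by (intro mult_right_mono one_le_power) auto
      then show ?thesis by (simp add: algebra_simps)
    qed
    ultimately show ?case by (rule difference_bound_mono) simp
  qed
  moreover have "?c ^ n \<le> exp (9 * U * (real n * \<tau>))"
  proof -
    have "?c ^ n \<le> exp (9 * U * \<tau>) ^ n" using c by (intro power_mono exp_ge_add_one_self) auto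
    then show ?thesis by (simp add: algebra_simps flip: exp_of_nat_mult)
  qed
  then have "?c ^ n * (E0 + real n * \<tau> * R) \<le> exp (9 * U * (real n * \<tau>)) * (E0 + real n * \<tau> * R)"
    using E0 \<tau> R by (intro mult_right_mono) auto
  ultimately show ?thesis by (rule difference_bound_mono) simp
qed

section \<open>Zero extension of \<open>C\<^sup>k\<close> functions\<close>

lemma Ck_on_cong:
  assumes "Ck_on k \<phi> S" "\<And>x. x \<in> S \<Longrightarrow> \<phi> x = \<psi> x"
  shows "Ck_on k \<psi> S"
proof (cases k)
  case 0 with assms show ?thesis by (auto cong: continuous_on_cong)
next
  case (Suc j)
  with assms(1) obtain \<phi>' where \<phi>': "\<And>x. x \<in> S \<Longrightarrow> (\<phi> has_derivative \<phi>' x) (at x within S)"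
    "\<forall>b\<in>Basis. Ck_on j (\<lambda>x. \<phi>' x b) S" by auto
  have "(\<psi> has_derivative \<phi>' x) (at x within S)" if "x \<in> S" for x
    by (rule has_derivative_transform[OF that _ \<phi>'(1)[OF that]]) (simp add: assms(2))
  then show ?thesis using \<phi>'(2) Suc by auto
qed

lemma Ck_on_subset:
  assumes "Ck_on k \<phi> S" "S' \<subseteq> S"
  shows "Ck_on k \<phi> S'"
  using assms(1)
proof (induction k arbitrary: \<phi>)
  case 0 then show ?case using assms(2) by (auto intro: continuous_on_subset)
next
  case (Suc k)
  then obtain \<phi>' where \<phi>': "\<And>x. x \<in> S \<Longrightarrow> (\<phi> has_derivative \<phi>' x) (at x within S)"
    "\<forall>b\<in>Basis. Ck_on k (\<lambda>x. \<phi>' x b) S" by auto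
  have "(\<phi> has_derivative \<phi>' x) (at x within S')" if "x \<in> S'" for x
    by (rule has_derivative_subset[OF \<phi>'(1)]) (use that assms(2) in auto)
  then show ?case using \<phi>'(2) Suc.IH by auto
qed

lemma Ck_on_vec_nth:
  assumes "Ck_on k \<phi> S"
  shows "Ck_on k (\<lambda>x. \<phi> x $ i) S"
  using assms
proof (induction k arbitrary: \<phi>)
  case 0 then show ?case by (auto intro!: continuous_intros)
next
  case (Suc k)
  then obtain \<phi>' where \<phi>': "\<And>x. x \<in> S \<Longrightarrow> (\<phi> has_derivative \<phi>' x) (at x within S)"
    "\<forall>b\<in>Basis. Ck_on k (\<lambda>x. \<phi>' x b) S" by auto
  have "((\<lambda>x. \<phi> x $ i) has_derivative (\<lambda>u. \<phi>' x u $ i)) (at x within S)" if "x \<in> S" for x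
    by (rule bounded_linear.has_derivative[OF bounded_linear_vec_nth \<phi>'(1)[OF that]])
  then show ?case using \<phi>'(2) Suc.IH unfolding Ck_on.simps
    by (intro exI[of _ "\<lambda>x u. \<phi>' x u $ i"]) auto
qed

lemma Ck_on_continuous: "Ck_on k \<phi> S \<Longrightarrow> continuous_on S \<phi>"
  by (cases k) (auto simp: continuous_on_eq_continuous_within intro: has_derivative_continuous)

text \<open>Openness of \<Omega> turns the derivative within the product into a full derivative in
  space; in time the slice stays within \<open>{0..T}\<close>. Linearity of \<open>D\<close> then
  gives the partials as its values on basis vectors.\<close>

lemma has_derivative_prod_slices:
  fixes \<phi> :: "real \<Rightarrow> R3 \<Rightarrow> real"
  assumes "((\<lambda>(t, x). \<phi> t x) has_derivative D) (at (t, x) within {0..T} \<times> \<Omega>)"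
    and "t \<in> {0..T}" "x \<in> \<Omega>" "open \<Omega>"
  shows "((\<lambda>s. \<phi> s x) has_real_derivative D (1, 0)) (at t within {0..T})"
    and "(\<phi> t has_derivative (\<lambda>u. \<Sum>i\<in>UNIV. u $ i * D (0, e i))) (at x)"
proof -
  interpret D: bounded_linear D using assms(1) by (rule has_derivative_bounded_linear)
  have "((\<lambda>s. (s, x)) has_derivative (\<lambda>s. (s, 0))) (at t within {0..T})"
    by (intro has_derivative_Pair has_derivative_const has_derivative_ident)
  moreover have "((\<lambda>(t, x). \<phi> t x) has_derivative D) (at (t, x) within (\<lambda>s. (s, x)) ` {0..T})"
    by (rule has_derivative_subset[OF assms(1)]) (use assms(3) in auto)
  ultimately have "((\<lambda>s. (case (s, x) of (t, x) \<Rightarrow> \<phi> t x)) has_derivative (\<lambda>s. D (s, 0))) (at t within {0..T})"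
    by (rule has_derivative_in_compose)
  moreover have "(\<lambda>s. D (s, 0)) = (*) (D (1, 0))"
  proof
    show "D (s, 0) = D (1, 0) * s" for s
    proof -
      have "D (s, 0) = D (s *\<^sub>R (1, 0))" by simp
      also have "\<dots> = s *\<^sub>R D (1, 0)" by (rule D.scaleR)
      finally show ?thesis by simp
    qed
  qed
  ultimately show "((\<lambda>s. \<phi> s x) has_real_derivative D (1, 0)) (at t within {0..T})"
    by (simp only: has_field_derivative_def prod.case)
  have "((\<lambda>y. (t, y)) has_derivative (\<lambda>u. (0, u))) (at x within \<Omega>)"
    by (intro has_derivative_Pair has_derivative_const has_derivative_ident)
  moreover have "((\<lambda>(t, x). \<phi> t x) has_derivative D) (at (t, x) within (\<lambda>y. (t, y)) ` \<Omega>)"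
    by (rule has_derivative_subset[OF assms(1)]) (use assms(2) in auto)
  ultimately have "((\<lambda>y. (case (t, y) of (t, x) \<Rightarrow> \<phi> t x)) has_derivative (\<lambda>u. D (0, u))) (at x within \<Omega>)"
    by (rule has_derivative_in_compose)
  moreover have "(\<lambda>u. D (0, u)) = (\<lambda>u. \<Sum>i\<in>UNIV. u $ i * D (0, e i))"
  proof
    fix u
    have "(\<Sum>i\<in>UNIV. (u $ i) *\<^sub>R e i) = u"
      by (simp add: vec_eq_iff axis_def if_distrib if_distribR cong: if_cong)
    then have "(0, u) = (\<Sum>i\<in>UNIV. (u $ i) *\<^sub>R (0 :: real, e i))"
      by (simp add: prod_eq_iff fst_sum snd_sum)
    then have "D (0, u) = D (\<Sum>i\<in>UNIV. (u $ i) *\<^sub>R (0, e i))" by (rule arg_cong)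
    also have "\<dots> = (\<Sum>i\<in>UNIV. u $ i * D (0, e i))" unfolding D.sum D.scaleR by simp
    finally show "D (0, u) = (\<Sum>i\<in>UNIV. u $ i * D (0, e i))" .
  qed
  ultimately show "(\<phi> t has_derivative (\<lambda>u. \<Sum>i\<in>UNIV. u $ i * D (0, e i))) (at x)"
    by (simp only: at_within_open[OF assms(3,4)] prod.case)
qed

text \<open>Off the closed set \<open>K\<close> the function vanishes near \<open>(t, x)\<close> in
  the strip, so its derivatives are 0. Any other candidate is 0 by uniqueness, which within a closed
  interval requires it to be nondegenerate.\<close>

lemma has_partials_unique_zero:
  assumes T: "T > 0" and t: "t \<in> {0..T}" and K: "closed K" "(t, x) \<notin> K"
    and zero: "\<forall>t\<in>{0..T}. \<forall>x. (t, x) \<notin> K \<longrightarrow> \<phi> t x = (0 :: real)"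
  shows "((\<lambda>s. \<phi> s x) has_real_derivative 0) (at t within {0..T})"
    and "(\<phi> t has_derivative (\<lambda>u :: R3. 0)) (at x)"
    and "((\<lambda>s. \<phi> s x) has_real_derivative d) (at t within {0..T}) \<Longrightarrow> d = 0"
    and "(\<phi> t has_derivative D) (at x) \<Longrightarrow> D u = 0"
proof -
  obtain r where r: "r > 0" "ball (t, x) r \<subseteq> - K"
    using K open_contains_ball[of "- K"] by (metis ComplI open_Compl)
  have near: "(s, y) \<notin> K" if "dist s t + dist y x < r" for s y
  proof -
    have "dist (t, x) (s, y) \<le> dist s t + dist y x"
      using sqrt_sum_squares_le_sum[of "dist s t" "dist y x"] by (simp add: dist_prod_def dist_commute)
    then have "(s, y) \<in> ball (t, x) r" using that by simp
    then show ?thesis using r(2) by blast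
  qed
  show 1: "((\<lambda>s. \<phi> s x) has_real_derivative 0) (at t within {0..T})"
    by (rule has_field_derivative_transform_within[where f="\<lambda>s. 0" and d=r])
       (use r t near[of _ x] zero in auto)
  show 2: "(\<phi> t has_derivative (\<lambda>u. 0)) (at x)"
    by (rule has_derivative_transform_within[where f="\<lambda>s. 0" and d=r])
       (use r t near[of t] zero in auto)
  show "d = 0" if "((\<lambda>s. \<phi> s x) has_real_derivative d) (at t within {0..T})"
    using vector_derivative_unique_within_closed_interval[of 0 T t "\<lambda>s. \<phi> s x" d 0] that 1 t T
    by (auto simp: has_real_derivative_iff_has_vector_derivative)
  show "D u = 0" if "(\<phi> t has_derivative D) (at x)"
    using has_derivative_unique[OF that 2] by simp
qed

text \<open>Continuity bounds the function on the compact set \<open>K\<close>, and elsewhere it is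
  0. The partials vanish off \<open>K\<close> as well, so they inherit the hypotheses and the
  induction on \<open>k\<close> goes through.\<close>

lemma bounded_Ck_zero_extension:
  assumes T: "T > 0" and \<Omega>: "open \<Omega>" and K: "compact K" "K \<subseteq> {0..T} \<times> \<Omega>"
    and "\<And>t x. t \<in> {0..T} \<Longrightarrow> (t, x) \<notin> K \<Longrightarrow> \<phi> t x = 0"
    and "Ck_on k (\<lambda>(t, x). \<phi> t x) ({0..T} \<times> \<Omega>)"
  shows "bounded_Ck T k \<phi>"
  using assms(5,6)
proof (induction k arbitrary: \<phi>)
  case (0 \<phi>)
  from 0(2) have "continuous_on K (\<lambda>(t, x). \<phi> t x)"
    using K(2) by (auto intro: continuous_on_subset)
  then have "bounded ((\<lambda>(t, x). \<phi> t x) ` K)" by (intro compact_imp_bounded compact_continuous_image K)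
  then obtain B where B: "\<forall>y\<in>(\<lambda>(t, x). \<phi> t x) ` K. norm y \<le> B" by (auto simp: bounded_iff)
  have "\<bar>\<phi> t x\<bar> \<le> \<bar>B\<bar>" if t: "t \<in> {0..T}" for t x
  proof (cases "(t, x) \<in> K")
    case True
    then have "norm (case (t, x) of (t, x) \<Rightarrow> \<phi> t x) \<le> B" using B by blast
    then show ?thesis by simp
  qed (simp add: 0(1)[OF t])
  then show ?case unfolding bounded_Ck.simps by blast
next
  case (Suc k \<phi>)
  have closedK: "closed K" using K(1) by (rule compact_imp_closed)
  have "continuous_on K (\<lambda>(t, x). \<phi> t x)"
    using Ck_on_continuous[OF Suc.prems(2)] K(2) by (rule continuous_on_subset)
  then have "bounded ((\<lambda>(t, x). \<phi> t x) ` K)" by (intro compact_imp_bounded compact_continuous_image K)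
  then obtain B where B: "\<forall>y\<in>(\<lambda>(t, x). \<phi> t x) ` K. norm y \<le> B" by (auto simp: bounded_iff)
  have bound: "\<bar>\<phi> t x\<bar> \<le> \<bar>B\<bar>" if t: "t \<in> {0..T}" for t x
  proof (cases "(t, x) \<in> K")
    case True
    then have "norm (case (t, x) of (t, x) \<Rightarrow> \<phi> t x) \<le> B" using B by blast
    then show ?thesis by simp
  qed (simp add: Suc.prems(1)[OF t])
  from Suc.prems(2) obtain D where
    D': "\<forall>p\<in>{0..T} \<times> \<Omega>. ((\<lambda>(t, x). \<phi> t x) has_derivative D p) (at p within {0..T} \<times> \<Omega>)"
    and Ck: "\<And>b. b \<in> Basis \<Longrightarrow> Ck_on k (\<lambda>p. D p b) ({0..T} \<times> \<Omega>)"
    unfolding Ck_on.simps by blast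
  have D: "((\<lambda>(t, x). \<phi> t x) has_derivative D (t, x)) (at (t, x) within {0..T} \<times> \<Omega>)"
    if "t \<in> {0..T}" "x \<in> \<Omega>" for t x using D' that by blast
  \<comment> \<open>Points off \<Omega> lie outside \<open>K\<close>, where the function is locally
    0, so 0 is the correct value of the derivatives there.\<close>
  define \<phi>t where "\<phi>t = (\<lambda>t x. if x \<in> \<Omega> then D (t, x) (1, 0) else 0)"
  define \<phi>x where "\<phi>x = (\<lambda>i t x. if x \<in> \<Omega> then D (t, x) (0, e i) else 0)"
  note slices = has_derivative_prod_slices[OF D _ _ \<Omega>]
  have "\<forall>t\<in>{0..T}. \<forall>x. (t, x) \<notin> K \<longrightarrow> \<phi> t x = 0" using Suc.prems(1) by blast
  note zero = has_partials_unique_zero[OF T _ closedK _ this]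
  have p: "has_partials T \<phi> \<phi>t \<phi>x"
    unfolding has_partials_def
  proof (intro ballI allI conjI)
    fix t x assume t: "t \<in> {0..T}"
    show "((\<lambda>s. \<phi> s x) has_real_derivative \<phi>t t x) (at t within {0..T})"
    proof (cases "x \<in> \<Omega>")
      case True then show ?thesis using slices(1)[OF t True t True] by (simp add: \<phi>t_def)
    next
      case False
      then have "(t, x) \<notin> K" using K(2) by auto
      then show ?thesis using zero(1)[OF t] False by (simp add: \<phi>t_def)
    qed
    show "(\<phi> t has_derivative (\<lambda>u. \<Sum>i\<in>UNIV. u $ i * \<phi>x i t x)) (at x)"
    proof (cases "x \<in> \<Omega>")
      case True then show ?thesis using slices(2)[OF t True t True] by (simp add: \<phi>x_def)
    next
      case False
      then have "(t, x) \<notin> K" using K(2) by auto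
      then show ?thesis using zero(2)[OF t] False by (simp add: \<phi>x_def)
    qed
  qed
  have "bounded_Ck T k \<phi>t"
  proof (rule Suc.IH)
    show "\<phi>t t x = 0" if "t \<in> {0..T}" "(t, x) \<notin> K" for t x
      using zero(3)[OF that] p that(1) unfolding has_partials_def by blast
    show "Ck_on k (\<lambda>(t, x). \<phi>t t x) ({0..T} \<times> \<Omega>)"
      by (rule Ck_on_cong[OF Ck[of "(1, 0)"]]) (auto simp: \<phi>t_def Basis_prod_def)
  qed
  moreover have "bounded_Ck T k (\<phi>x i)" for i
  proof (rule Suc.IH)
    show "\<phi>x i t x = 0" if "t \<in> {0..T}" "(t, x) \<notin> K" for t x
    proof -
      have "(\<Sum>j\<in>UNIV. e i $ j * \<phi>x j t x) = 0"
        using zero(4)[OF that] p that(1) unfolding has_partials_def by blast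
      then show ?thesis by (simp add: axis_def if_distrib if_distribR cong: if_cong)
    qed
    show "Ck_on k (\<lambda>(t, x). \<phi>x i t x) ({0..T} \<times> \<Omega>)"
      by (rule Ck_on_cong[OF Ck[of "(0, e i)"]]) (auto simp: \<phi>x_def Basis_prod_def)
  qed
  ultimately show ?case using p bound unfolding bounded_Ck.simps by blast
qed

section \<open>Derivatives of the transport equation in terms of partials\<close>

lemma vector_derivative_has_partials:
  assumes "T > 0" "has_partials T \<phi> \<phi>t \<phi>x" "t \<in> {0..T}"
  shows "vector_derivative (\<lambda>s. \<phi> s x) (at t within {0..T}) = \<phi>t t x"
  using assms vector_derivative_within_cbox[of 0 T t "\<lambda>s. \<phi> s x" "\<phi>t t x"]
  by (auto simp: has_partials_def has_real_derivative_iff_has_vector_derivative)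

lemma grad_has_partials:
  assumes "has_partials T \<phi> \<phi>t \<phi>x" "t \<in> {0..T}"
  shows "grad (\<phi> t) x = (\<chi> i. \<phi>x i t x)"
proof -
  have "frechet_derivative (\<phi> t) (at x) = (\<lambda>u. \<Sum>i\<in>UNIV. u $ i * \<phi>x i t x)"
    using assms by (intro frechet_derivative_at[symmetric]) (simp add: has_partials_def)
  then show ?thesis
    by (simp add: grad_def vec_eq_iff axis_def if_distrib if_distribR cong: if_cong)
qed

section \<open>Convergence of differences up to second order\<close>

lemma difference_lipschitz_mono:
  assumes "difference_lipschitz T h M \<phi>" "M \<le> M'"
  shows "difference_lipschitz T h M' \<phi>"
proof -
  have "M * d \<le> M' * d" if "d \<ge> 0" for d using assms(2) that by (rule mult_right_mono)
  then show ?thesis using assms(1) unfolding difference_lipschitz_def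
    by (meson add_nonneg_nonneg abs_ge_zero norm_ge_zero order_trans)
qed

lemma scheme_step_diff:
  "scheme_step h \<tau> u (\<lambda>x. \<phi> x - \<psi> x) x = scheme_step h \<tau> u \<phi> x - scheme_step h \<tau> u \<psi> x"
proof -
  have "Dcentral h j (\<lambda>x. \<phi> x - \<psi> x) x = Dcentral h j \<phi> x - Dcentral h j \<psi> x" for j
    by (simp add: Dcentral_def diff_divide_distrib)
  then show ?thesis by (simp add: scheme_step_def sum_subtractf right_diff_distrib)
qed

text \<open>On a shift-closed set differences see only values on that set. This matters because the
  scheme and the initial averages are prescribed at grid points only.\<close>

lemma difference_bound_cong:
  assumes X: "shift_closed h X" and "difference_bound X h M \<phi>" and eq: "\<And>x. x \<in> X \<Longrightarrow> \<phi> x = \<psi> x"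
  shows "difference_bound X h M \<psi>"
proof -
  have "L \<phi> x = L \<psi> x" if "L \<in> difference_ops h" "x \<in> X" for L x
    using that
    by (induction arbitrary: x rule: difference_ops_induct) (use X eq in \<open>auto simp: Dplus_def shift_closed_def\<close>)
  then show ?thesis using assms(2) unfolding difference_bound_def by metis
qed

text \<open>The error splits into a time Taylor remainder, second space differences from the
  1/7-average, and \<open>\<tau>\<close> times the errors of the averaged velocity and of the
  central quotient. The transport equation cancels the terms of first order in
  \<open>\<tau>\<close>.\<close>

lemma consistency:
  assumes p: "has_partials T f ft fx" and t: "\<tau> * real n \<in> {0..T}" "\<tau> * (real n + 1) \<in> {0..T}"
    and h: "0 < h" "h \<le> 1" and \<tau>: "0 < \<tau>" and M: "M \<ge> 0"
    and lip: "difference_lipschitz T h M ft" "\<And>j. difference_lipschitz T h M (fx j)"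
      "\<And>j. difference_lipschitz T h M (\<lambda>t x. v t x $ j)"
    and bound: "\<And>j t. t \<in> {0..T} \<Longrightarrow> difference_bound UNIV h M (fx j t)"
      "\<And>j t. t \<in> {0..T} \<Longrightarrow> difference_bound UNIV h M (\<lambda>x. v t x $ j)"
    and transport: "\<And>t x. t \<in> {0..T} \<Longrightarrow> ft t x + (\<Sum>j\<in>UNIV. v t x $ j * fx j t x) = 0"
  shows "difference_bound UNIV h ((M + 60 * M\<^sup>2) * (\<tau>\<^sup>2 + h\<^sup>2 + \<tau> * h))
    (\<lambda>x. f (\<tau> * (real n + 1)) x - scheme_step h \<tau> (velocity_average v h \<tau> n) (f (\<tau> * real n)) x)"
proof -
  let ?t = "\<tau> * real n" and ?u = "velocity_average v h \<tau> n"
  have t': "\<tau> * (real n + 1) = ?t + \<tau>" by (simp add: algebra_simps)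
  have A: "difference_bound UNIV h (M * \<tau>\<^sup>2) (\<lambda>x. f (?t + \<tau>) x - f ?t x - \<tau> * ft ?t x)"
    by (rule difference_bound_time_taylor[OF p lip(1)]) (use t \<tau> t' in auto)
  have S: "difference_bound UNIV h (2 * M * h\<^sup>2) (\<lambda>x. f ?t (x + h *\<^sub>R e j) + f ?t (x - h *\<^sub>R e j) - 2 * f ?t x)" for j
    by (rule difference_bound_second_difference[OF p lip(2) t(1) h(1)])
  have C: "difference_bound UNIV h (M * h) (\<lambda>x. Dcentral h j (f ?t) x - fx j ?t x)" for j
    by (rule difference_bound_Dcentral[OF p lip(2) t(1) h(1)])
  have "difference_bound UNIV h (M * h + M) (Dcentral h j (f ?t))" for j
    using difference_bound_add[OF C bound(1)[OF t(1)], of j j] by simp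
  moreover have "M * h + M \<le> 2 * M" using h M mult_left_le[of h M] by simp
  ultimately have Dc: "difference_bound UNIV h (2 * M) (Dcentral h j (f ?t))" for j
    by (rule difference_bound_mono) simp
  have V: "difference_bound UNIV h (2 * M * (\<tau> + h)) (\<lambda>x. ?u j x - v ?t x $ j)" for j
    by (rule difference_bound_velocity_average[OF h(1) \<tau> _ lip(3)]) (use t in simp)
  have P: "difference_bound UNIV h (4 * (2 * M * (\<tau> + h) * (2 * M)) + 4 * (M * (M * h)))
      (\<lambda>x. (?u j x - v ?t x $ j) * Dcentral h j (f ?t) x + v ?t x $ j * (Dcentral h j (f ?t) x - fx j ?t x))" for j
    by (intro difference_bound_add difference_bound_mult shift_closed_UNIV V Dc C bound t(1))
  \<comment> \<open>The last part equals \<open>\<tau> * (48 * M^2 * \<tau> + 60 * M^2 * h)\<close>,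
    the origin of the 60; the diffusion part is 6/7 * M * h^2.\<close>
  let ?b = "M * \<tau>\<^sup>2 + \<bar>1 / 7\<bar> * (\<Sum>j\<in>(UNIV :: 3 set). 2 * M * h\<^sup>2)
      + \<bar>\<tau>\<bar> * (\<Sum>j\<in>(UNIV :: 3 set). 4 * (2 * M * (\<tau> + h) * (2 * M)) + 4 * (M * (M * h)))"
  have "difference_bound UNIV h ?b
    (\<lambda>x. f (?t + \<tau>) x - f ?t x - \<tau> * ft ?t x
      - 1 / 7 * (\<Sum>j\<in>UNIV. f ?t (x + h *\<^sub>R e j) + f ?t (x - h *\<^sub>R e j) - 2 * f ?t x)
      + \<tau> * (\<Sum>j\<in>UNIV. (?u j x - v ?t x $ j) * Dcentral h j (f ?t) x
          + v ?t x $ j * (Dcentral h j (f ?t) x - fx j ?t x)))"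
    by (intro difference_bound_add difference_bound_diff difference_bound_cmult difference_bound_sum A S P)
  moreover have "f (?t + \<tau>) x - f ?t x - \<tau> * ft ?t x
      - 1 / 7 * (\<Sum>j\<in>UNIV. f ?t (x + h *\<^sub>R e j) + f ?t (x - h *\<^sub>R e j) - 2 * f ?t x)
      + \<tau> * (\<Sum>j\<in>UNIV. (?u j x - v ?t x $ j) * Dcentral h j (f ?t) x
          + v ?t x $ j * (Dcentral h j (f ?t) x - fx j ?t x))
    = f (\<tau> * (real n + 1)) x - scheme_step h \<tau> ?u (f ?t) x" for x
  proof -
    have "ft ?t x = - (\<Sum>j\<in>UNIV. v ?t x $ j * fx j ?t x)" using transport[OF t(1), of x] by linarith
    then show ?thesis unfolding t' scheme_step_def sum_stencil
      by (simp add: sum.distrib sum_subtractf algebra_simps)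
  qed
  ultimately have "difference_bound UNIV h ?b
      (\<lambda>x. f (\<tau> * (real n + 1)) x - scheme_step h \<tau> ?u (f ?t) x)" by simp
  moreover have "?b \<le> (M + 60 * M\<^sup>2) * (\<tau>\<^sup>2 + h\<^sup>2 + \<tau> * h)"
  proof -
    have "(M + 60 * M\<^sup>2) * (\<tau>\<^sup>2 + h\<^sup>2 + \<tau> * h) - ?b
        = 1 / 7 * (M * h\<^sup>2) + M * (\<tau> * h) + 12 * (M\<^sup>2 * \<tau>\<^sup>2) + 60 * (M\<^sup>2 * h\<^sup>2)"
      using \<tau> by (simp add: power2_eq_square algebra_simps)
    also have "\<dots> \<ge> 0" using M h \<tau> by simp
    finally show ?thesis by linarith
  qed
  ultimately show ?thesis by (rule difference_bound_mono) simp
qed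

lemma scheme_convergence:
  assumes T: "T > 0" and f4: "bounded_Ck T 4 f" and v3: "\<And>j. bounded_Ck T 3 (\<lambda>t x. v t x $ j)"
    and transport: "\<And>t x. t \<in> {0..T} \<Longrightarrow>
      vector_derivative (\<lambda>s. f s x) (at t within {0..T}) + v t x \<bullet> grad (f t) x = 0"
    and \<alpha>: "0 < \<alpha>" "\<alpha> \<le> 1" and K: "K > 0"
  shows "\<exists>C\<ge>0. \<forall>h \<tau> N g n. 0 < h \<and> h \<le> 1 \<and> 0 < \<tau> \<and> \<tau> * real N \<le> T \<and> scale_condition \<alpha> K h \<tau> \<and>
    CFL_condition v h \<tau> N \<and> explicit_scheme v (f 0) h \<tau> N g \<and> n \<le> N \<longrightarrow>
    difference_bound (grid h) h (C * h powr \<alpha>) (\<lambda>x. g n x - f (\<tau> * real n) x)"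
proof -
  obtain ft fx where p: "has_partials T f ft fx" and ft: "bounded_Ck T 3 ft" and fx: "\<And>i. bounded_Ck T 3 (fx i)"
    using f4 bounded_Ck_partials[of T 3 f] by (auto simp: eval_nat_numeral simp del: bounded_Ck.simps)
  \<comment> \<open>One finite index type collects \<open>f\<close>, \<open>ft\<close>, the
    \<open>fx j\<close> and the components of \<open>v\<close>, so that a single \<open>M\<close>
    serves all Lipschitz and sup bounds.\<close>
  define W where "W = (\<lambda>i. case i of None \<Rightarrow> f | Some None \<Rightarrow> ft | Some (Some (Inl j)) \<Rightarrow> fx j
    | Some (Some (Inr j)) \<Rightarrow> (\<lambda>t x. v t x $ j))"
  have "bounded_Ck T 3 f" using f4 by (rule bounded_Ck_mono) simp
  then have W3: "bounded_Ck T 3 (W i)" for i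
    using ft fx v3 by (auto simp: W_def split: option.split sum.split)
  have W2: "bounded_Ck T 2 (W i)" for i using W3 by (rule bounded_Ck_mono) simp
  have "\<exists>M\<ge>0. \<forall>i. (\<forall>h>0. difference_lipschitz T h M (W i) \<and> (\<forall>t\<in>{0..T}. difference_bound UNIV h M (W i t)))"
  proof (rule finite_uniform_bound)
    fix i
    obtain M1 M2 where M1: "M1 \<ge> 0" "\<forall>h>0. difference_lipschitz T h M1 (W i)"
      and M2: "M2 \<ge> 0" "\<forall>h>0. \<forall>t\<in>{0..T}. difference_bound UNIV h M2 (W i t)"
      using bounded_Ck_difference_lipschitz[OF W3] bounded_Ck_difference_bound[OF W2] by metis
    then show "\<exists>M\<ge>0. \<forall>h>0. difference_lipschitz T h M (W i) \<and> (\<forall>t\<in>{0..T}. difference_bound UNIV h M (W i t))"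
      by (intro exI[of _ "max M1 M2"])
         (auto intro: difference_lipschitz_mono difference_bound_mono[OF _ max.cobounded2 subset_refl])
  qed (blast intro: difference_lipschitz_mono difference_bound_mono)
  then obtain M where M: "M \<ge> 0" and lip: "\<And>i h. h > 0 \<Longrightarrow> difference_lipschitz T h M (W i)"
    and bd: "\<And>i h t. h > 0 \<Longrightarrow> t \<in> {0..T} \<Longrightarrow> difference_bound UNIV h M (W i t)" by blast
  note lipf = lip[of _ None, unfolded W_def option.case]
    and lipft = lip[of _ "Some None", unfolded W_def option.case]
    and lipfx = lip[of _ "Some (Some (Inl j))" for j, unfolded W_def option.case sum.case]
    and lipv = lip[of _ "Some (Some (Inr j))" for j, unfolded W_def option.case sum.case]
    and bdfx = bd[of _ _ "Some (Some (Inl j))" for j, unfolded W_def option.case sum.case]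
    and bdv = bd[of _ _ "Some (Some (Inr j))" for j, unfolded W_def option.case sum.case]
  have transport': "ft t x + (\<Sum>j\<in>UNIV. v t x $ j * fx j t x) = 0" if "t \<in> {0..T}" for t x
    using transport[OF that, of x]
    by (simp add: vector_derivative_has_partials[OF T p that] grad_has_partials[OF p that] inner_vec_def)
  \<comment> \<open>\<open>U\<close> bounds the averaged velocity: \<open>M\<close> for
    \<open>v\<close> itself plus the averaging error \<open>2 * M * (\<tau> + h)\<close>. In
    \<open>C\<close>, the term \<open>2 * M\<close> stems from the initial averages and
    \<open>T * (Q * K)\<close> from the truncation errors accumulated up to time
    \<open>T\<close>.\<close>
  define U where "U = M + 2 * M * (T + 1)"
  define Q where "Q = M + 60 * M\<^sup>2"
  define C where "C = exp (9 * U * T) * (2 * M + T * (Q * K))"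
  have U: "U \<ge> 0" and Q: "Q \<ge> 0" using M T by (auto simp: U_def Q_def)
  have C: "C \<ge> 0" using M T Q K by (auto simp: C_def)
  show ?thesis
  proof (intro exI[of _ C] conjI C allI impI, elim conjE)
    fix h \<tau> N g n
    assume h: "0 < h" "h \<le> 1" and \<tau>: "0 < \<tau>" and N: "\<tau> * real N \<le> T"
      and sc: "scale_condition \<alpha> K h \<tau>" and cfl: "CFL_condition v h \<tau> N"
      and scheme: "explicit_scheme v (f 0) h \<tau> N g" and n: "n \<le> N"
    let ?u = "velocity_average v h \<tau>" and ?\<psi> = "\<lambda>n x. g n x - f (\<tau> * real n) x"
    have tn: "\<tau> * real m \<in> {0..T}" if "m \<le> N" for m
    proof -
      have "\<tau> * real m \<le> \<tau> * real N" using that \<tau> by (intro mult_left_mono) auto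
      then show ?thesis using order_trans[OF _ N] \<tau> by simp
    qed
    have tS: "\<tau> * real m \<in> {0..T}" "\<tau> * (real m + 1) \<in> {0..T}" if "m < N" for m
      using tn[of m] tn[of "Suc m"] that by (auto simp: algebra_simps)
    have hp: "h \<le> h powr \<alpha>" using powr_mono'[of \<alpha> 1 h] h \<alpha> by simp
    have "difference_bound (grid h) h (exp (9 * U * (real n * \<tau>)) * (2 * M * h + real n * \<tau> * (Q * K * h powr \<alpha>))) (?\<psi> n)"
    proof (rule difference_bound_iterate[where \<psi>="?\<psi>" and N=N and u="?u"])
      show "0 \<le> 1 / 7 + \<tau> / (2 * h) * ?u m j x" "0 \<le> 1 / 7 - \<tau> / (2 * h) * ?u m j x" if "m < N" "x \<in> grid h" for m j x
        using cfl that by (auto simp: CFL_condition_def)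
      show "difference_bound (grid h) h U (?u m j)" if "m < N" for m j
      proof -
        have "difference_bound UNIV h (2 * M * (\<tau> + h)) (\<lambda>x. ?u m j x - v (\<tau> * real m) x $ j)"
          by (rule difference_bound_velocity_average[OF h(1) \<tau> _ lipv[OF h(1)]]) (use tS[OF that] in simp)
        from difference_bound_add[OF this bdv[OF h(1) tS(1)[OF that], of j]]
        have "difference_bound UNIV h (2 * M * (\<tau> + h) + M) (?u m j)" by simp
        \<comment> \<open>A step \<open>m < N\<close> exists, so \<open>\<tau>\<close> itself is at
          most \<open>T\<close>.\<close>
        moreover have "\<tau> + h \<le> T + 1"
        proof -
          have "\<tau> * 1 \<le> \<tau> * (real m + 1)" using \<tau> by (intro mult_left_mono) auto
          then show ?thesis using tS(2)[OF that] h by auto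
        qed
        then have "2 * M * (\<tau> + h) + M \<le> U" using M unfolding U_def by (simp add: mult_left_mono)
        ultimately show ?thesis by (rule difference_bound_mono) simp
      qed
      have "difference_bound UNIV h (2 * M * h) (\<lambda>x. cell_average h (f 0) x - f 0 x)"
        by (rule difference_bound_cell_average[OF h(1) lipf[OF h(1)]]) (use T in simp)
      then have "difference_bound (grid h) h (2 * M * h) (\<lambda>x. cell_average h (f 0) x - f 0 x)"
        by (rule difference_bound_mono) auto
      then show "difference_bound (grid h) h (2 * M * h) (?\<psi> 0)"
        by (rule difference_bound_cong[OF shift_closed_grid])
           (use scheme in \<open>simp add: explicit_scheme_def cell_average_def\<close>)
      fix m assume m: "m < N"
      have cons: "difference_bound UNIV h (Q * (\<tau>\<^sup>2 + h\<^sup>2 + \<tau> * h))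
         (\<lambda>x. f (\<tau> * (real m + 1)) x - scheme_step h \<tau> (?u m) (f (\<tau> * real m)) x)"
        unfolding Q_def
        by (rule consistency[OF p tS[OF m] h \<tau> M lipft lipfx lipv bdfx bdv transport']) (use h in auto)
      \<comment> \<open>The second half of the scale condition turns each truncation error into
        \<open>\<tau>\<close> times O(h^\<alpha>), the form that the Gronwall argument
        expects.\<close>
      have "Q * (\<tau>\<^sup>2 + h\<^sup>2 + \<tau> * h) \<le> Q * (K * (h powr \<alpha> * \<tau>))"
        using sc Q unfolding scale_condition_def by (intro mult_left_mono) auto
      then have Qb: "\<bar>-1\<bar> * (Q * (\<tau>\<^sup>2 + h\<^sup>2 + \<tau> * h)) \<le> \<tau> * (Q * K * h powr \<alpha>)"
        by (simp add: algebra_simps)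
      have "difference_bound (grid h) h (\<tau> * (Q * K * h powr \<alpha>))
         (\<lambda>x. -1 * (f (\<tau> * (real m + 1)) x - scheme_step h \<tau> (?u m) (f (\<tau> * real m)) x))"
        by (rule difference_bound_mono[OF difference_bound_cmult[OF cons] Qb]) simp
      then show "difference_bound (grid h) h (\<tau> * (Q * K * h powr \<alpha>))
         (\<lambda>x. ?\<psi> (Suc m) x - scheme_step h \<tau> (?u m) (?\<psi> m) x)"
      proof (rule difference_bound_cong[OF shift_closed_grid])
        fix x assume x: "x \<in> grid h"
        have "(g (Suc m) x - 1 / 7 * (\<Sum>\<omega>\<in>stencil. g m (x + h *\<^sub>R \<omega>))) * (1 / \<tau>)
            + (\<Sum>j\<in>UNIV. ?u m j x * Dcentral h j (g m) x) = 0"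
          using scheme m x unfolding explicit_scheme_def by blast
        then have "g (Suc m) x = scheme_step h \<tau> (?u m) (g m) x"
          using \<tau> unfolding scheme_step_def by (simp add: field_simps)
        then show "-1 * (f (\<tau> * (real m + 1)) x - scheme_step h \<tau> (?u m) (f (\<tau> * real m)) x)
            = ?\<psi> (Suc m) x - scheme_step h \<tau> (?u m) (?\<psi> m) x"
          by (simp add: scheme_step_diff algebra_simps)
      qed
    qed (use h \<tau> U M Q K n in auto)
    moreover have "exp (9 * U * (real n * \<tau>)) * (2 * M * h + real n * \<tau> * (Q * K * h powr \<alpha>)) \<le> C * h powr \<alpha>"
    proof -
      have nT: "real n * \<tau> \<le> T" using tn[OF n] by (simp add: mult.commute)
      have "2 * M * h + real n * \<tau> * (Q * K * h powr \<alpha>) \<le> 2 * M * h powr \<alpha> + T * (Q * K * h powr \<alpha>)"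
        using nT hp M Q K h T by (intro add_mono mult_mono) auto
      moreover have "exp (9 * U * (real n * \<tau>)) \<le> exp (9 * U * T)"
        using nT U by (simp add: mult_left_mono)
      ultimately have "exp (9 * U * (real n * \<tau>)) * (2 * M * h + real n * \<tau> * (Q * K * h powr \<alpha>))
          \<le> exp (9 * U * T) * (2 * M * h powr \<alpha> + T * (Q * K * h powr \<alpha>))"
        using M h \<tau> Q K by (intro mult_mono) auto
      then show ?thesis by (simp add: C_def algebra_simps)
    qed
    ultimately show "difference_bound (grid h) h (C * h powr \<alpha>) (?\<psi> n)" by (rule difference_bound_mono) simp
  qed
qed

section \<open>Normal and mean curvature as functions of first and second derivatives\<close>

text \<open>The quotient rule for -div(p/|p|), for a field with value \<open>p\<close> and
  derivative matrix \<open>H\<close>. Exact and discrete curvature are values of this one function,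
  so comparing them is a matter of its Lipschitz continuity.\<close>

definition curvature_of :: "R3 \<Rightarrow> (3 \<Rightarrow> 3 \<Rightarrow> real) \<Rightarrow> real" where
  "curvature_of p H = - (1 / norm p) * ((\<Sum>i\<in>UNIV. H i i)
     - (\<Sum>i\<in>UNIV. \<Sum>j\<in>UNIV. H i j * (p $ i / norm p) * (p $ j / norm p)))"

lemma discrete_mean_curvature_eq:
  "discrete_mean_curvature h G y
     = curvature_of (discrete_grad h G y) (\<lambda>i j. Dminus h i (Dplus h j G) y)"
proof -
  have "Dsecond h i G y = Dminus h i (Dplus h i G) y" for i
    by (simp add: Dsecond_def Dminus_def Dplus_def power2_eq_square divide_simps)
  then show ?thesis by (simp add: discrete_mean_curvature_def curvature_of_def discrete_normal_def)
qed

text \<open>Differentiates \<open>G / norm G\<close> for the gradient \<open>G\<close>.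
  \<open>\<psi>x j i\<close> is the derivative in direction \<open>i\<close> of the
  \<open>j\<close>-th partial, the order matching \<open>Dminus h i (Dplus h j G)\<close>, so
  symmetry of the Hessian is never invoked.\<close>

lemma mean_curvature_eq:
  assumes p: "has_partials T \<phi> \<phi>t \<phi>x" and q: "\<And>i. has_partials T (\<phi>x i) (\<psi>t i) (\<psi>x i)"
    and t: "t \<in> {0..T}" and nz: "grad (\<phi> t) z \<noteq> 0"
  shows "mean_curvature \<phi> t z = curvature_of (grad (\<phi> t) z) (\<lambda>i j. \<psi>x j i t z)"
proof -
  define G where "G = (\<lambda>x. \<chi> i. \<phi>x i t x)"
  define G' where "G' = (\<lambda>u. \<chi> i. \<Sum>j\<in>UNIV. u $ j * \<psi>x i j t z)"
  have gr: "grad (\<phi> t) = G" using grad_has_partials[OF p t] by (simp add: G_def fun_eq_iff)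
  have nz': "G z \<noteq> 0" using nz gr by simp
  have "((\<lambda>x. G x \<bullet> b) has_derivative (\<lambda>u. G' u \<bullet> b)) (at z)" if "b \<in> Basis" for b
  proof -
    obtain i where "b = e i" using \<open>b \<in> Basis\<close> by (auto simp: Basis_vec_def)
    then show ?thesis using q[of i] t by (simp add: G_def G'_def inner_axis has_partials_def)
  qed
  then have G: "(G has_derivative G') (at z)" by (subst has_derivative_componentwise_within) auto
  define n where "n = norm (G z)"
  have n: "n > 0" using nz' by (simp add: n_def)
  have N: "((\<lambda>x. norm (G x)) has_derivative (\<lambda>u. sgn (G z) \<bullet> G' u)) (at z)"
    using has_derivative_compose[OF G has_derivative_norm[OF nz']] by (simp add: inner_commute)
  have "((\<lambda>x. inverse (norm (G x)) *\<^sub>R G x) has_derivative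
      (\<lambda>u. inverse n *\<^sub>R G' u + (- (inverse n * (sgn (G z) \<bullet> G' u) * inverse n)) *\<^sub>R G z)) (at z)"
    unfolding n_def by (rule has_derivative_scaleR[OF Deriv.has_derivative_inverse[OF _ N] G]) (simp add: nz')
  moreover have "normal \<phi> t = (\<lambda>x. inverse (norm (G x)) *\<^sub>R G x)"
    by (simp add: normal_def[abs_def] gr inverse_eq_divide)
  ultimately have F: "frechet_derivative (normal \<phi> t) (at z) =
      (\<lambda>u. inverse n *\<^sub>R G' u + (- (inverse n * (sgn (G z) \<bullet> G' u) * inverse n)) *\<^sub>R G z)"
    by (simp only: frechet_derivative_at[symmetric])
  have G'e: "G' (e i) $ j = \<psi>x j i t z" for i j
    by (simp add: G'_def axis_def if_distrib if_distribR cong: if_cong)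
  have "divergence (normal \<phi> t) z = (\<Sum>i\<in>UNIV. inverse n * \<psi>x i i t z
      - inverse n * (\<Sum>j\<in>UNIV. (G z $ j / n) * \<psi>x j i t z) * (G z $ i / n))"
    unfolding divergence_def F
    by (simp add: G'e inner_vec_def sgn_div_norm n_def[symmetric] sum_distrib_left divide_inverse algebra_simps)
  also have "\<dots> = 1 / n * ((\<Sum>i\<in>UNIV. \<psi>x i i t z)
     - (\<Sum>i\<in>UNIV. \<Sum>j\<in>UNIV. \<psi>x j i t z * (G z $ i / n) * (G z $ j / n)))"
    by (simp add: sum_subtractf sum_distrib_left sum_distrib_right right_diff_distrib divide_inverse mult_ac)
  finally show ?thesis by (simp add: mean_curvature_def curvature_of_def gr n_def)
qed

text \<open>Inserting \<open>p\<close> divided by \<open>norm q\<close>, the change of vector and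
  the change of length each cost \<open>norm (p - q) / norm q\<close>. For \<open>p = 0\<close> the
  left-hand side is 1.\<close>

lemma norm_normalize_diff:
  fixes p q :: "'a::real_normed_vector"
  assumes "q \<noteq> 0"
  shows "norm ((1 / norm p) *\<^sub>R p - (1 / norm q) *\<^sub>R q) \<le> 2 * norm (p - q) / norm q"
proof (cases "p = 0")
  case True then show ?thesis using assms by simp
next
  case False
  have "(1 / norm p) *\<^sub>R p - (1 / norm q) *\<^sub>R q = (1 / norm q) *\<^sub>R (p - q) + (1 / norm p - 1 / norm q) *\<^sub>R p"
    by (simp add: algebra_simps)
  also have "norm \<dots> \<le> norm (p - q) / norm q + \<bar>1 / norm p - 1 / norm q\<bar> * norm p"
    by (rule norm_triangle_le) simp
  also have "\<bar>1 / norm p - 1 / norm q\<bar> * norm p = \<bar>norm q - norm p\<bar> / norm q"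
  proof -
    have "1 / norm p - 1 / norm q = (norm q - norm p) / (norm p * norm q)"
      using False assms by (simp add: field_simps)
    then show ?thesis using False assms by (simp add: abs_divide)
  qed
  also have "\<bar>norm q - norm p\<bar> / norm q \<le> norm (p - q) / norm q"
    using norm_triangle_ineq3[of q p] by (intro divide_right_mono) (auto simp: norm_minus_commute)
  finally show ?thesis by simp
qed

text \<open>\<open>norm p\<close> stays above \<open>C / 2\<close>. The bracket has 3 + 9 terms and
  changes by at most \<open>12 * \<eta> + 36 * M * \<eta> / C\<close>, to be multiplied by
  \<open>2 / C\<close>; the change \<open>2 * \<eta> / C^2\<close> of the reciprocal norm meets a
  bracket of size \<open>12 * M\<close>. The total is 24 and 72 + 24 = 96.\<close>

lemma curvature_of_diff:
  assumes C: "C > 0" "C \<le> norm q" and pq: "norm (p - q) \<le> \<eta>" "\<eta> \<le> C / 2"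
    and H: "\<And>i j. \<bar>H i j - X i j\<bar> \<le> \<eta>" and X: "\<And>i j. \<bar>X i j\<bar> \<le> M"
  shows "\<bar>curvature_of p H - curvature_of q X\<bar> \<le> (24 / C + 96 * M / C\<^sup>2) * \<eta>"
proof -
  define a b where "a = (\<lambda>i. p $ i / norm p)" and "b = (\<lambda>i. q $ i / norm q)"
  have \<eta>: "\<eta> \<ge> 0" using pq(1) norm_ge_zero order_trans by blast
  have M: "M \<ge> 0" using X abs_ge_zero order_trans by blast
  have np: "norm p \<ge> C / 2" using norm_triangle_ineq3[of p q] pq C by linarith
  have a1: "\<bar>a i\<bar> \<le> 1" and b1: "\<bar>b i\<bar> \<le> 1" for i
    using component_le_norm_cart[of p i] component_le_norm_cart[of q i]
    by (auto simp: a_def b_def abs_divide divide_le_eq_1)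
  have ab: "\<bar>a i - b i\<bar> \<le> 2 * \<eta> / C" for i
  proof -
    have "\<bar>a i - b i\<bar> = \<bar>((1 / norm p) *\<^sub>R p - (1 / norm q) *\<^sub>R q) $ i\<bar>" by (simp add: a_def b_def)
    also have "\<dots> \<le> norm ((1 / norm p) *\<^sub>R p - (1 / norm q) *\<^sub>R q)" by (rule component_le_norm_cart)
    also have "\<dots> \<le> 2 * norm (p - q) / norm q" using C by (intro norm_normalize_diff) auto
    also have "\<dots> \<le> 2 * \<eta> / C" using C pq \<eta> by (intro frac_le) auto
    finally show ?thesis .
  qed
  have quad: "\<bar>H i j * a i * a j - X i j * b i * b j\<bar> \<le> \<eta> + M * (4 * \<eta> / C)" for i j
  proof -
    have "H i j * a i * a j - X i j * b i * b j
      = (H i j - X i j) * (a i * a j) + X i j * ((a i - b i) * a j + b i * (a j - b j))"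
      by (simp add: algebra_simps)
    moreover have "\<bar>(H i j - X i j) * (a i * a j)\<bar> \<le> \<eta> * (1 * 1)"
      unfolding abs_mult using H a1 \<eta> by (intro mult_mono) auto
    moreover have "\<bar>X i j * ((a i - b i) * a j + b i * (a j - b j))\<bar> \<le> M * (2 * \<eta> / C * 1 + 1 * (2 * \<eta> / C))"
      unfolding abs_mult
    proof (intro mult_mono X abs_triangle_ineq[THEN order_trans] add_mono M)
      show "\<bar>(a i - b i) * a j\<bar> \<le> 2 * \<eta> / C * 1" unfolding abs_mult
        by (rule mult_mono[OF ab a1]) (use \<eta> C in auto)
      show "\<bar>b i * (a j - b j)\<bar> \<le> 1 * (2 * \<eta> / C)" unfolding abs_mult
        by (rule mult_mono[OF b1 ab]) (use \<eta> C in auto)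
    qed simp
    ultimately show ?thesis by (simp add: abs_le_iff)
  qed
  define S S' where "S = (\<Sum>i\<in>UNIV. H i i) - (\<Sum>i\<in>UNIV. \<Sum>j\<in>UNIV. H i j * a i * a j)"
    and "S' = (\<Sum>i\<in>UNIV. X i i) - (\<Sum>i\<in>UNIV. \<Sum>j\<in>UNIV. X i j * b i * b j)"
  have "S - S' = (\<Sum>i\<in>UNIV. H i i - X i i) - (\<Sum>i\<in>UNIV. \<Sum>j\<in>UNIV. H i j * a i * a j - X i j * b i * b j)"
    by (simp add: S_def S'_def sum_subtractf)
  moreover have "\<bar>\<Sum>i\<in>UNIV. H i i - X i i\<bar> \<le> (\<Sum>i\<in>(UNIV :: 3 set). \<eta>)"
    by (intro sum_abs[THEN order_trans] sum_mono H)
  moreover have "\<bar>\<Sum>i\<in>UNIV. \<Sum>j\<in>UNIV. H i j * a i * a j - X i j * b i * b j\<bar>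
      \<le> (\<Sum>i\<in>(UNIV :: 3 set). \<Sum>j\<in>(UNIV :: 3 set). \<eta> + M * (4 * \<eta> / C))"
    by (intro sum_abs[THEN order_trans] sum_mono quad)
  ultimately have SS': "\<bar>S - S'\<bar> \<le> 12 * \<eta> + 36 * M * \<eta> / C" by (simp add: algebra_simps)
  have "\<bar>X i j * b i * b j\<bar> \<le> M * 1 * 1" for i j
    unfolding abs_mult using X b1 M by (intro mult_mono) auto
  then have "\<bar>\<Sum>i\<in>UNIV. \<Sum>j\<in>UNIV. X i j * b i * b j\<bar> \<le> (\<Sum>i\<in>(UNIV :: 3 set). \<Sum>j\<in>(UNIV :: 3 set). M)"
    by (intro sum_abs[THEN order_trans] sum_mono) auto
  moreover have "\<bar>\<Sum>i\<in>UNIV. X i i\<bar> \<le> (\<Sum>i\<in>(UNIV :: 3 set). M)"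
    by (intro sum_abs[THEN order_trans] sum_mono X)
  ultimately have S': "\<bar>S'\<bar> \<le> 12 * M" unfolding S'_def by simp
  have inv: "\<bar>1 / norm p - 1 / norm q\<bar> \<le> 2 * \<eta> / C\<^sup>2"
  proof -
    have pos: "norm p > 0" "norm q > 0" using np C by linarith+
    then have "1 / norm p - 1 / norm q = (norm q - norm p) / (norm p * norm q)"
      by (simp add: field_simps)
    then have "\<bar>1 / norm p - 1 / norm q\<bar> = \<bar>norm q - norm p\<bar> / (norm p * norm q)"
      by (simp add: abs_divide abs_mult)
    also have "\<dots> \<le> \<eta> / (C / 2 * C)"
      using norm_triangle_ineq3[of q p] pq C np \<eta>
      by (intro frac_le mult_mono) (auto simp: norm_minus_commute)
    finally show ?thesis by (simp add: power2_eq_square mult.commute)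
  qed
  have "curvature_of p H = - (1 / norm p) * S" "curvature_of q X = - (1 / norm q) * S'"
    by (simp_all add: curvature_of_def S_def S'_def a_def b_def)
  then have "curvature_of q X - curvature_of p H = (1 / norm p) * (S - S') + (1 / norm p - 1 / norm q) * S'"
    by (simp add: algebra_simps diff_divide_distrib)
  moreover have "\<bar>(1 / norm p) * (S - S')\<bar> \<le> (2 / C) * (12 * \<eta> + 36 * M * \<eta> / C)"
  proof -
    have "1 / norm p \<le> 1 / (C / 2)" using np C by (intro frac_le) auto
    then show ?thesis unfolding abs_mult using SS' C by (intro mult_mono) auto
  qed
  moreover have "\<bar>(1 / norm p - 1 / norm q) * S'\<bar> \<le> (2 * \<eta> / C\<^sup>2) * (12 * M)"
    unfolding abs_mult using inv S' \<eta> by (intro mult_mono) auto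
  moreover have "(2 / C) * (12 * \<eta> + 36 * M * \<eta> / C) + (2 * \<eta> / C\<^sup>2) * (12 * M) = (24 / C + 96 * M / C\<^sup>2) * \<eta>"
    using C by (simp add: field_simps power2_eq_square)
  ultimately show ?thesis by linarith
qed

text \<open>Differences are taken at \<open>y\<close> and derivatives at \<open>z\<close>, because
  the discrete quantities live on the grid and the exact ones at the associated point.\<close>

lemma discrete_derivative_error:
  assumes f4: "bounded_Ck T 4 f"
  shows "\<exists>B\<ge>0. \<exists>fx \<psi>x. \<forall>t\<in>{0..T}. (\<forall>x. grad (f t) x = (\<chi> i. fx i t x)) \<and>
    (\<forall>x. grad (f t) x \<noteq> 0 \<longrightarrow>
       mean_curvature f t x = curvature_of (grad (f t) x) (\<lambda>i j. \<psi>x j i t x)) \<and>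
    (\<forall>i j x. \<bar>\<psi>x i j t x\<bar> \<le> B) \<and>
    (\<forall>h>0. \<forall>i y z. \<bar>Dplus h i (f t) y - fx i t z\<bar> \<le> B * (h + norm (y - z))) \<and>
    (\<forall>h>0. \<forall>i j y z. \<bar>Dplus h i (Dplus h j (f t)) y - \<psi>x j i t z\<bar> \<le> B * (h + norm (y - z)))"
proof -
  have "bounded_Ck T (Suc 3) f" using f4 by (simp del: bounded_Ck.simps add: eval_nat_numeral)
  then obtain ft fx where p: "has_partials T f ft fx" and fx: "\<And>i. bounded_Ck T 3 (fx i)"
    using bounded_Ck_partials by blast
  have "\<forall>i. \<exists>\<psi>t \<psi>x. has_partials T (fx i) \<psi>t \<psi>x \<and> (\<forall>j. bounded_Ck T 2 (\<psi>x j))"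
    using fx bounded_Ck_partials[of T 2] by (metis Suc_1 numeral_3_eq_3 numeral_2_eq_2)
  then obtain \<psi>t \<psi>x where q: "\<And>i. has_partials T (fx i) (\<psi>t i) (\<psi>x i)" and \<psi>2: "\<And>i j. bounded_Ck T 2 (\<psi>x i j)"
    by metis
  have \<psi>1: "bounded_Ck T 1 (\<psi>x i j)" for i j using \<psi>2 by (rule bounded_Ck_mono) simp
  obtain M1 where M1: "M1 \<ge> 0" "\<And>i h. h > 0 \<Longrightarrow> difference_lipschitz T h M1 (fx i)"
  proof -
    have "\<exists>M\<ge>0. \<forall>i. \<forall>h>0. difference_lipschitz T h M (fx i)"
      by (rule finite_uniform_bound) (use bounded_Ck_difference_lipschitz[OF fx] difference_lipschitz_mono in blast)+
    then show thesis using that by blast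
  qed
  obtain M2 where M2: "M2 \<ge> 0" "\<And>i j t x. t \<in> {0..T} \<Longrightarrow> \<bar>\<psi>x i j t x\<bar> \<le> M2"
    "\<And>i j t x y. t \<in> {0..T} \<Longrightarrow> \<bar>\<psi>x i j t y - \<psi>x i j t x\<bar> \<le> M2 * norm (y - x)"
  proof -
    have "\<exists>M\<ge>0. \<forall>ij. \<forall>t\<in>{0..T}. \<forall>x y. \<bar>\<psi>x (fst ij) (snd ij) t x\<bar> \<le> M \<and>
        \<bar>\<psi>x (fst ij) (snd ij) t y - \<psi>x (fst ij) (snd ij) t x\<bar> \<le> M * norm (y - x)"
    proof (rule finite_uniform_bound)
      fix ij M M'
      assume "\<forall>t\<in>{0..T}. \<forall>x y. \<bar>\<psi>x (fst ij) (snd ij) t x\<bar> \<le> M \<and>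
        \<bar>\<psi>x (fst ij) (snd ij) t y - \<psi>x (fst ij) (snd ij) t x\<bar> \<le> M * norm (y - x)" "M \<le> M'"
      moreover from this have "M * norm u \<le> M' * norm u" for u :: R3 by (intro mult_right_mono) auto
      ultimately show "\<forall>t\<in>{0..T}. \<forall>x y. \<bar>\<psi>x (fst ij) (snd ij) t x\<bar> \<le> M' \<and>
        \<bar>\<psi>x (fst ij) (snd ij) t y - \<psi>x (fst ij) (snd ij) t x\<bar> \<le> M' * norm (y - x)"
        by (meson order_trans)
    qed (rule bounded_Ck_lipschitz[OF \<psi>1])
    then obtain M where "M \<ge> 0" "\<And>ij. \<forall>t\<in>{0..T}. \<forall>x y. \<bar>\<psi>x (fst ij) (snd ij) t x\<bar> \<le> M \<and>
        \<bar>\<psi>x (fst ij) (snd ij) t y - \<psi>x (fst ij) (snd ij) t x\<bar> \<le> M * norm (y - x)" by blast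
    then show thesis using that[of M] by (metis fst_conv snd_conv)
  qed
  have grad: "grad (f t) x = (\<chi> i. fx i t x)" if "t \<in> {0..T}" for t x
    by (rule grad_has_partials[OF p that])
  have curv: "mean_curvature f t x = curvature_of (grad (f t) x) (\<lambda>i j. \<psi>x j i t x)"
    if "t \<in> {0..T}" "grad (f t) x \<noteq> 0" for t x
    using mean_curvature_eq[OF p q that] by simp
  \<comment> \<open>Stated for all \<open>L\<close> because \<open>L = Dplus h i\<close> replaces a
    second difference of \<open>f\<close> by one difference of \<open>fx j\<close> with error
    \<open>M1 * h\<close>; \<open>D2\<close> handles what remains.\<close>
  have D1: "\<bar>L (Dplus h i (f t)) x - L (fx i t) x\<bar> \<le> M1 * h" if "0 < h" "t \<in> {0..T}" "L \<in> difference_ops h" for h i t L x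
    using difference_bound_Dplus[OF p M1(2)[OF that(1)] that(2,1), of i] that(3)
    by (simp add: difference_bound_def difference_ops_diff)
  have D2: "\<bar>Dplus h i (fx j t) x - \<psi>x j i t x\<bar> \<le> M2 * h" if h: "0 < h" and t: "t \<in> {0..T}" for h i j t x
  proof -
    have "\<bar>fx j t (x + h *\<^sub>R e i) - fx j t x - h * \<psi>x j i t x\<bar> \<le> M2 * h\<^sup>2"
      by (rule has_partials_space_taylor[OF q t M2(1) M2(3)[OF t]])
    moreover have "h * (Dplus h i (fx j t) x - \<psi>x j i t x) = fx j t (x + h *\<^sub>R e i) - fx j t x - h * \<psi>x j i t x"
      using h by (simp add: Dplus_def field_simps)
    ultimately have "\<bar>h * (Dplus h i (fx j t) x - \<psi>x j i t x)\<bar> \<le> h * (M2 * h)"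
      by (simp add: power2_eq_square mult_ac)
    then show ?thesis using h by (simp add: abs_mult)
  qed
  have fxL: "\<bar>fx i t y - fx i t z\<bar> \<le> M1 * norm (y - z)" if "t \<in> {0..T}" for i t y z
    using difference_lipschitzD[OF M1(2)[of 1 i] difference_ops_intros(1) that that, of y z] by simp
  show ?thesis
  proof (intro exI[of _ "M1 + M2"] exI[of _ fx] exI[of _ \<psi>x] ballI conjI allI impI)
    fix t x and i j assume t: "t \<in> {0..T}"
    show "grad (f t) x = (\<chi> i. fx i t x)" by (rule grad[OF t])
    show "mean_curvature f t x = curvature_of (grad (f t) x) (\<lambda>i j. \<psi>x j i t x)" if "grad (f t) x \<noteq> 0"
      by (rule curv[OF t that])
    show "\<bar>\<psi>x i j t x\<bar> \<le> M1 + M2" using M2(2)[OF t, of i j x] M1(1) by linarith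
    fix h :: real and y z :: R3 assume h: "h > 0"
    have nn: "0 \<le> M1 * norm (y - z)" "0 \<le> M2 * norm (y - z)" "0 \<le> M1 * h" "0 \<le> M2 * h"
      using h M1(1) M2(1) by auto
    show "\<bar>Dplus h i (f t) y - fx i t z\<bar> \<le> (M1 + M2) * (h + norm (y - z))"
      using D1[OF h t difference_ops_intros(1), of i y] fxL[OF t, of i y z] nn
      by (simp add: distrib_left distrib_right)
    show "\<bar>Dplus h i (Dplus h j (f t)) y - \<psi>x j i t z\<bar> \<le> (M1 + M2) * (h + norm (y - z))"
      using D1[OF h t difference_ops_intros(2)[of h i], of j y] D2[OF h t, of i j y] M2(3)[OF t, of j i y z] nn
      by (simp add: distrib_left distrib_right)
  qed (use M1(1) M2(1) in auto)
qed

section \<open>Errors of normal and curvature on the discrete surface\<close>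

theorem theorem5p2:
  fixes T \<alpha> K \<mu>0 C1 C2 M13 :: real
    and \<Omega> \<Omega>p :: "(real^3) set"
    and v :: "real \<Rightarrow> real^3 \<Rightarrow> real^3"
    and f0 :: "real^3 \<Rightarrow> real"
    and f :: "real \<Rightarrow> real^3 \<Rightarrow> real"
  assumes T: "T > 0"
    and Omega: "open \<Omega>" "connected \<Omega>" "bounded \<Omega>"
    and v_C4: "Ck_on 4 (\<lambda>(t, x). v t x) ({0..T} \<times> closure \<Omega>)"
    and v_div: "\<forall>t\<in>{0..T}. \<forall>x\<in>\<Omega>. divergence (v t) x = 0"
    and v_supp: "closure {(t, x). t \<in> {0..T} \<and> x \<in> closure \<Omega> \<and> v t x \<noteq> 0} \<subseteq> {0..T} \<times> \<Omega>"
    and v_ext: "\<forall>t\<in>{0..T}. \<forall>x. x \<notin> \<Omega> \<longrightarrow> v t x = 0"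
    and f0_C4: "Ck_on 4 f0 (closure \<Omega>)"
    and f0_zero: "\<exists>U. open U \<and> frontier \<Omega> \<subseteq> U \<and> (\<forall>x \<in> U \<inter> closure \<Omega>. f0 x = 0)"
    and f0_ext: "\<forall>x. x \<notin> \<Omega> \<longrightarrow> f0 x = 0"
    and Omegap: "open \<Omega>p" "connected \<Omega>p" "closure \<Omega>p \<subseteq> \<Omega>"
    and f0_in: "\<forall>x\<in>\<Omega>p. f0 x > 1"
    and f0_out: "\<forall>x\<in>\<Omega> - closure \<Omega>p. f0 x < 1"
    and f0_grad: "\<forall>x\<in>frontier \<Omega>p. grad f0 x \<noteq> 0"
    and f_C4: "Ck_on 4 (\<lambda>(t, x). f t x) ({0..T} \<times> UNIV)"
    and f_transport: "\<forall>t\<in>{0..T}. \<forall>x.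
          vector_derivative (\<lambda>s. f s x) (at t within {0..T}) + v t x \<bullet> grad (f t) x = 0"
    and f_init: "\<forall>x. f 0 x = f0 x"
    and mu0: "\<mu>0 > 0" "tube \<Omega> f T \<mu>0 \<subseteq> {0..T} \<times> \<Omega>"
    and C12: "0 < C1" "C1 \<le> C2"
      "\<forall>(t, x)\<in>tube \<Omega> f T \<mu>0. C1 \<le> norm (grad (f t) x) \<and> norm (grad (f t) x) \<le> C2"
    and alpha: "0 < \<alpha>" "\<alpha> \<le> 1"
    and K: "K > 0"
    and M13: "M13 > 0"
  shows "\<exists>M14 > 0. \<exists>M15 > 0. \<exists>\<delta> > 0. \<forall>h \<tau> N g.
    0 < h \<and> h < \<delta> \<and> 0 < \<tau> \<and> \<tau> < \<delta> \<and>
    T \<in> {\<tau> * real N..<\<tau> * real N + \<tau>} \<and>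
    scale_condition \<alpha> K h \<tau> \<and> CFL_condition v h \<tau> N \<and> explicit_scheme v f0 h \<tau> N g \<longrightarrow>
    (\<forall>n\<le>N. \<forall>y\<in>discrete_surface \<Omega> h (g n). \<forall>z.
       associated_point \<Omega> f \<mu>0 M13 \<alpha> h (real n * \<tau>) y z \<longrightarrow>
         norm (discrete_normal h (g n) y - normal f (real n * \<tau>) z) \<le> M14 * h powr \<alpha> \<and>
         \<bar>discrete_mean_curvature h (g n) y - mean_curvature f (real n * \<tau>) z\<bar> \<le> M15 * h powr \<alpha>)"
proof -
  have v0: "v t x = 0" if "t \<in> {0..T}"
    "(t, x) \<notin> closure {(t, x). t \<in> {0..T} \<and> x \<in> closure \<Omega> \<and> v t x \<noteq> 0}" for t x
  proof (cases "x \<in> closure \<Omega>")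
    case True
    then show ?thesis using that closure_subset[of "{(t, x). t \<in> {0..T} \<and> x \<in> closure \<Omega> \<and> v t x \<noteq> 0}"] by blast
  next
    case False
    then have "x \<notin> \<Omega>" using closure_subset by blast
    then show ?thesis using v_ext that(1) by blast
  qed
  \<comment> \<open>The closed support of \<open>v\<close> is the set \<open>K\<close> of the
    extension lemma: compact because \<Omega> is bounded, and inside the open domain by
    \<open>v_supp\<close>.\<close>
  have v4: "bounded_Ck T 4 (\<lambda>t x. v t x $ j)" for j
  proof (rule bounded_Ck_zero_extension[OF T Omega(1) _ v_supp])
    have "{(t, x). t \<in> {0..T} \<and> x \<in> closure \<Omega> \<and> v t x \<noteq> 0} \<subseteq> {0..T} \<times> closure \<Omega>" by auto
    moreover have "compact ({0..T} \<times> closure \<Omega>)" using Omega(3) by (intro compact_Times) auto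
    ultimately show "compact (closure {(t, x). t \<in> {0..T} \<and> x \<in> closure \<Omega> \<and> v t x \<noteq> 0})"
      by (meson bounded_subset compact_closure compact_imp_bounded)
    have "{0..T} \<times> \<Omega> \<subseteq> {0..T} \<times> closure \<Omega>" using closure_subset by auto
    from Ck_on_vec_nth[OF Ck_on_subset[OF v_C4 this], of j]
    show "Ck_on 4 (\<lambda>(t, x). v t x $ j) ({0..T} \<times> \<Omega>)" by (simp add: case_prod_unfold)
  qed (use v0 in simp)
  have v3: "bounded_Ck T 3 (\<lambda>t x. v t x $ j)" for j using v4 by (rule bounded_Ck_mono) simp
  \<comment> \<open>Where the velocity vanishes, the transport equation says that \<open>f\<close>
    is constant in time, so outside \<Omega> it keeps its initial value 0.\<close>
  have f_zero: "f t x = 0" if t: "t \<in> {0..T}" and x: "x \<notin> \<Omega>" for t x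
  proof -
    have "((\<lambda>s. f s x) has_vector_derivative 0) (at s within {0..T})" if s: "s \<in> {0..T}" for s
    proof -
      from f_C4 obtain D where "\<forall>p\<in>{0..T} \<times> UNIV.
          ((\<lambda>(t, x). f t x) has_derivative D p) (at p within {0..T} \<times> UNIV)"
        unfolding eval_nat_numeral Ck_on.simps by blast
      then have "((\<lambda>(t, x). f t x) has_derivative D (s, x)) (at (s, x) within {0..T} \<times> UNIV)"
        using s by blast
      then have D: "((\<lambda>s. f s x) has_vector_derivative D (s, x) (1, 0)) (at s within {0..T})"
        using has_derivative_prod_slices(1)[of f "D (s, x)" s x T UNIV] s
        by (simp add: has_real_derivative_iff_has_vector_derivative)
      have "vector_derivative (\<lambda>s. f s x) (at s within {0..T}) = D (s, x) (1, 0)"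
        using vector_derivative_within_cbox[of 0 T s] D s T by simp
      moreover have "vector_derivative (\<lambda>s. f s x) (at s within {0..T}) = 0"
        using bspec[OF f_transport s, rule_format, of x] bspec[OF v_ext s, rule_format, OF x] by simp
      ultimately show ?thesis using D by simp
    qed
    then obtain c where "\<And>s. s \<in> {0..T} \<Longrightarrow> f s x = c"
      using has_vector_derivative_zero_constant[of "{0..T}" "\<lambda>s. f s x"] by auto
    then have "f t x = f 0 x" using t T by simp
    then show ?thesis using f_init f0_ext x by simp
  qed
  have f4: "bounded_Ck T 4 f"
  \<comment> \<open>\<open>f\<close> is regular on all of space, so the open set is
    \<open>UNIV\<close> and \<open>K\<close> may reach the boundary of \<Omega>.\<close>
  proof (rule bounded_Ck_zero_extension[OF T open_UNIV _ _ _ f_C4])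
    show "compact ({0..T} \<times> closure \<Omega>)" using Omega(3) by (intro compact_Times) auto
    show "f t x = 0" if "t \<in> {0..T}" "(t, x) \<notin> {0..T} \<times> closure \<Omega>" for t x
      using that f_zero closure_subset by blast
  qed auto
  have f_init': "f 0 = f0" using f_init by auto
  have "vector_derivative (\<lambda>s. f s x) (at t within {0..T}) + v t x \<bullet> grad (f t) x = 0"
    if "t \<in> {0..T}" for t x using f_transport that by blast
  from scheme_convergence[OF T f4 v3 this alpha K, unfolded f_init'] obtain C where C: "C \<ge> 0"
    and conv: "\<And>h \<tau> N g n. 0 < h \<and> h \<le> 1 \<and> 0 < \<tau> \<and> \<tau> * real N \<le> T \<and>
      scale_condition \<alpha> K h \<tau> \<and> CFL_condition v h \<tau> N \<and> explicit_scheme v f0 h \<tau> N g \<and> n \<le> N \<longrightarrow>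
      difference_bound (grid h) h (C * h powr \<alpha>) (\<lambda>x. g n x - f (\<tau> * real n) x)"
    by auto
  from discrete_derivative_error[OF f4] obtain B fx \<psi>x where B: "B \<ge> 0" and
    fx: "\<forall>t\<in>{0..T}. (\<forall>x. grad (f t) x = (\<chi> i. fx i t x)) \<and>
      (\<forall>x. grad (f t) x \<noteq> 0 \<longrightarrow>
         mean_curvature f t x = curvature_of (grad (f t) x) (\<lambda>i j. \<psi>x j i t x)) \<and>
      (\<forall>i j x. \<bar>\<psi>x i j t x\<bar> \<le> B) \<and>
      (\<forall>h>0. \<forall>i y z. \<bar>Dplus h i (f t) y - fx i t z\<bar> \<le> B * (h + norm (y - z))) \<and>
      (\<forall>h>0. \<forall>i j y z. \<bar>Dplus h i (Dplus h j (f t)) y - \<psi>x j i t z\<bar> \<le> B * (h + norm (y - z)))"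
    by (elim exE conjE)
  have gr: "grad (f t) x = (\<chi> i. fx i t x)"
    and curv: "grad (f t) x \<noteq> 0 \<Longrightarrow>
       mean_curvature f t x = curvature_of (grad (f t) x) (\<lambda>i j. \<psi>x j i t x)"
    and \<psi>B: "\<bar>\<psi>x i j t x\<bar> \<le> B"
    and D1: "0 < h \<Longrightarrow> \<bar>Dplus h i (f t) y - fx i t z\<bar> \<le> B * (h + norm (y - z))"
    and D2: "0 < h \<Longrightarrow> \<bar>Dplus h i (Dplus h j (f t)) y - \<psi>x j i t z\<bar> \<le> B * (h + norm (y - z))"
    if "t \<in> {0..T}" for t x y z h i j
    using bspec[OF fx that] by blast+
  \<comment> \<open>\<open>C\<close> is the error of the scheme. In \<open>2 + M13\<close> one unit
    is the Taylor error \<open>h\<close>, one the shift by \<open>h\<close> hidden in a backward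
    difference, and \<open>M13\<close> the distance from \<open>y\<close> to the associated point.
    The 1 ensures \<open>A > 0\<close>.\<close>
  define A where "A = C + B * (2 + M13) + 1"
  have A: "A > 0" using C B M13 by (simp add: A_def add_nonneg_pos)
  \<comment> \<open>Chosen so that \<open>h < \<delta>\<close> forces
    \<open>3 * A * h powr \<alpha> \<le> C1 / 2\<close>, which keeps the discrete gradient away from
    0.\<close>
  define \<delta> where "\<delta> = min 1 ((C1 / (6 * A)) powr (1 / \<alpha>))"
  have \<delta>: "\<delta> > 0" using C12(1) A by (simp add: \<delta>_def)
  \<comment> \<open>\<open>3 * A\<close> bounds the gradient error, as the sum of three component
    errors. The first witness is \<open>2 * (3 * A) / C1\<close> from normalization, the second the
    Lipschitz constant of \<open>curvature_of\<close> times \<open>3 * A\<close>.\<close>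
  show ?thesis
  proof (rule exI[of _ "6 * A / C1"], rule conjI[rotated],
      rule exI[of _ "(24 / C1 + 96 * B / C1\<^sup>2) * (3 * A)"], rule conjI[rotated],
      rule exI[of _ \<delta>], rule conjI[rotated], intro conjI allI impI ballI)
    show "0 < 6 * A / C1" "0 < \<delta>" using A C12(1) \<delta> by auto
    show "0 < (24 / C1 + 96 * B / C1\<^sup>2) * (3 * A)"
      using A C12(1) B by (intro mult_pos_pos add_pos_nonneg) auto
    fix h \<tau> N g n y z
    assume hyp: "0 < h \<and> h < \<delta> \<and> 0 < \<tau> \<and> \<tau> < \<delta> \<and> T \<in> {\<tau> * real N..<\<tau> * real N + \<tau>} \<and>
        scale_condition \<alpha> K h \<tau> \<and> CFL_condition v h \<tau> N \<and> explicit_scheme v f0 h \<tau> N g"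
      and n: "n \<le> N" and y: "y \<in> discrete_surface \<Omega> h (g n)"
      and z: "associated_point \<Omega> f \<mu>0 M13 \<alpha> h (real n * \<tau>) y z"
    let ?t = "real n * \<tau>" and ?p = "discrete_grad h (g n) y" and ?e = "\<lambda>x. g n x - f (real n * \<tau>) x"
    let ?q = "grad (f ?t) z" and ?\<eta> = "3 * A * h powr \<alpha>"
    have h: "0 < h" "h \<le> 1" using hyp by (auto simp: \<delta>_def)
    have "real n * \<tau> \<le> real N * \<tau>" using n hyp by (intro mult_right_mono) auto
    moreover have "real N * \<tau> \<le> T" "0 \<le> real n * \<tau>" using hyp by (simp_all add: mult.commute)
    ultimately have t: "?t \<in> {0..T}" unfolding atLeastAtMost_iff by linarith
    have err: "difference_bound (grid h) h (C * h powr \<alpha>) ?e"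
      using conv[of h \<tau> N g n] hyp h n by (simp add: mult.commute)
    have hp: "h \<le> h powr \<alpha>" using powr_mono'[of \<alpha> 1 h] h alpha by simp
    have sh: "x + h *\<^sub>R e i \<in> grid h" "x - h *\<^sub>R e i \<in> grid h" if "x \<in> grid h" for x i
      using shift_closed_grid[of h] that by (auto simp: shift_closed_def)
    have yg: "y \<in> grid h"
    proof -
      obtain x \<omega> where "x \<in> grid h" "\<omega> \<in> stencil" "y = x + h *\<^sub>R \<omega>"
        using y by (auto simp: discrete_surface_def discrete_boundary_def discrete_inside_def grid_domain_def)
      then show ?thesis using sh[of x] by (auto simp: stencil_def)
    qed
    have yz: "norm (y - z) \<le> M13 * h powr \<alpha>"
      using z by (auto simp: associated_point_def norm_minus_commute)
    have zl: "z \<in> level_surface \<Omega> f ?t" using z by (simp add: associated_point_def)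
    \<comment> \<open>\<open>z\<close> is on the surface, at distance 0 from itself, so it lies in
      the tube and the lower gradient bound \<open>C1\<close> holds there.\<close>
    then have "(?t, z) \<in> tube \<Omega> f T \<mu>0"
      using t mu0(1) by (auto simp: tube_def level_surface_def intro!: bexI[of _ z])
    then have q: "C1 \<le> norm ?q" using C12(3) by blast
    then have q0: "?q \<noteq> 0" using C12(1) by auto
    have total: "C * h powr \<alpha> + B * (h + norm (x - z)) \<le> A * h powr \<alpha>" if "norm (x - z) \<le> norm (y - z) + h" for x
    proof -
      have "h + norm (x - z) \<le> (2 + M13) * h powr \<alpha>"
        using that yz hp by (simp add: distrib_right)
      then have "B * (h + norm (x - z)) \<le> B * ((2 + M13) * h powr \<alpha>)" using B by (rule mult_left_mono)
      moreover have "0 \<le> h powr \<alpha>" by simp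
      moreover have "A * h powr \<alpha> = C * h powr \<alpha> + B * ((2 + M13) * h powr \<alpha>) + h powr \<alpha>"
        by (simp add: A_def algebra_simps)
      ultimately show ?thesis by linarith
    qed
    have first: "\<bar>?p $ i - ?q $ i\<bar> \<le> A * h powr \<alpha>" for i
    proof -
      have "?p $ i - ?q $ i = Dplus h i ?e y + (Dplus h i (f ?t) y - fx i ?t z)"
        by (simp add: discrete_grad_def gr[OF t] difference_ops_diff[OF difference_ops_intros(2)])
      also have "\<bar>\<dots>\<bar> \<le> C * h powr \<alpha> + B * (h + norm (y - z))"
        by (rule abs_triangle_ineq[THEN order_trans, OF add_mono[OF difference_boundD(2)[OF err yg] D1[OF t h(1)]]])
      finally show ?thesis using total[of y] h by simp
    qed
    have pq: "norm (?p - ?q) \<le> ?\<eta>"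
    proof -
      have "norm (?p - ?q) \<le> (\<Sum>i\<in>UNIV. \<bar>(?p - ?q) $ i\<bar>)" by (rule norm_le_l1_cart)
      also have "\<dots> \<le> (\<Sum>i\<in>(UNIV :: 3 set). A * h powr \<alpha>)" by (intro sum_mono) (use first in simp)
      finally show ?thesis by simp
    qed
    have second: "\<bar>Dminus h i (Dplus h j (g n)) y - \<psi>x j i ?t z\<bar> \<le> A * h powr \<alpha>" for i j
    proof -
      let ?y = "y - h *\<^sub>R e i"
      have y': "?y \<in> grid h" by (rule sh[OF yg])
      have "norm (?y - z) \<le> norm (y - z) + h"
        using norm_triangle_ineq4[of "y - z" "h *\<^sub>R e i"] h by (simp add: norm_axis_1 algebra_simps)
      note total = total[OF this]
      \<comment> \<open>A backward difference at \<open>y\<close> is a forward one at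
        \<open>?y\<close>, which is again a grid point, so the error bound for forward differences
        applies.\<close>
      have "Dminus h i (Dplus h j (g n)) y = Dplus h i (Dplus h j (g n)) ?y"
        by (simp add: Dminus_def Dplus_def)
      then have "Dminus h i (Dplus h j (g n)) y - \<psi>x j i ?t z
          = Dplus h i (Dplus h j ?e) ?y + (Dplus h i (Dplus h j (f ?t)) ?y - \<psi>x j i ?t z)"
        by (simp add: difference_ops_diff[OF difference_ops_intros(2)])
      also have "\<bar>\<dots>\<bar> \<le> C * h powr \<alpha> + B * (h + norm (?y - z))"
        by (rule abs_triangle_ineq[THEN order_trans, OF add_mono[OF difference_boundD(3)[OF err y'] D2[OF t h(1)]]])
      finally show ?thesis using total by linarith
    qed
    have "h powr \<alpha> \<le> ((C1 / (6 * A)) powr (1 / \<alpha>)) powr \<alpha>"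
      using hyp h alpha by (intro powr_mono2) (auto simp: \<delta>_def)
    then have "h powr \<alpha> \<le> C1 / (6 * A)" using alpha C12(1) A by (simp add: powr_powr)
    then have \<eta>: "?\<eta> \<le> C1 / 2" using A by (simp add: field_simps)
    have A\<eta>: "A * h powr \<alpha> \<le> ?\<eta>" using A by simp
    have "norm (discrete_normal h (g n) y - normal f ?t z) \<le> 2 * norm (?p - ?q) / norm ?q"
      unfolding discrete_normal_def normal_def by (rule norm_normalize_diff[OF q0])
    also have "\<dots> \<le> 2 * ?\<eta> / C1" using pq q C12(1) A by (intro frac_le) auto
    finally show "norm (discrete_normal h (g n) y - normal f ?t z) \<le> 6 * A / C1 * h powr \<alpha>" by simp
    have "\<bar>curvature_of ?p (\<lambda>i j. Dminus h i (Dplus h j (g n)) y) - curvature_of ?q (\<lambda>i j. \<psi>x j i ?t z)\<bar>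
        \<le> (24 / C1 + 96 * B / C1\<^sup>2) * ?\<eta>"
      by (rule curvature_of_diff[OF C12(1) q pq \<eta>]) (use order_trans[OF second A\<eta>] \<psi>B[OF t] in auto)
    then show "\<bar>discrete_mean_curvature h (g n) y - mean_curvature f ?t z\<bar>
        \<le> (24 / C1 + 96 * B / C1\<^sup>2) * (3 * A) * h powr \<alpha>"
      by (simp add: discrete_mean_curvature_eq curv[OF t q0] mult.assoc)
  qed
qed

end
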